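(* Let $(M,\omega)$ be a compact connected quantizable Kähler manifold with very ample quantum line bundle $(L,h)$, and let $i:M\to\mathbb{P}^N(\mathbb{C})$ be the coherent state embedding. Let $x,y,z\in M$ and let $$a=d_C(i(x),i(y)),\quad b=d_C(i(y),i(z)),\quad c=d_C(i(z),i(x))$$ be the Cayley distances in $\mathbb{P}^N(\mathbb{C})$, where $0<a,b,c<\pi/2$. Then the three-point function $$\Psi_M^{(3)}(x,y,z)=\frac{\langle e_q,e_{q'}\rangle\langle e_{q'},e_{q''}\rangle\langle e_{q''},e_q\rangle}{\|e_q\|^2\|e_{q'}\|^2\|e_{q''}\|^2},\qquad x=\pi(q),\ y=\pi(q'),\ z=\pi(q''),$$ can be written as $$\Psi_M^{(3)}(x,y,z)=\cos a\cdot\cos b\cdot\cos c\cdot e^{\mathrm{i}\Phi}$$ with phase $$\Phi=\int_{\tilde\sigma(i(x),i(y),i(z))}\omega_{FS},$$ where $\tilde\sigma(i(x),i(y),i(z))$ is any deformation of the (oriented) geodesic triangle (in $\mathbb{P}^N(\mathbb{C})$) with fixed boundary given by the geodesics (in $\mathbb{P}^N(\mathbb{C})$) connecting the points $i(x)$, $i(y)$ and $i(z)$.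
   Context: Quantum line bundle: a holomorphic line bundle $\pi:L\to M$ over the Kähler manifold $(M,\omega)$ with hermitian metric $h$ such that the connection compatible with $h$ and the complex structure has curvature $F=-\mathrm{i}\,\omega$. If $\hat h$ is the local function representing $h$ in a holomorphic frame, this means $\omega=\mathrm{i}\,\bar\partial\partial\log\hat h$. $M$ is quantizable if such a bundle exists. $L$ very ample means that a basis of the global holomorphic sections of $L$ defines a holomorphic embedding of $M$ into projective space. All hermitian metrics and scalar products are conjugate linear in the first argument; on $\mathbb{C}^{N+1}$, $\langle u,v\rangle=\sum_j\bar u_jv_j$. Scalar product on the space $\Gamma_{hol}(M,L)$ of global holomorphic sections: $\langle\varphi,\psi\rangle=\int_M h(\varphi,\psi)\,\Omega$, $\|\varphi\|=\sqrt{\langle\varphi,\varphi\rangle}$, with volume form $\Omega=(-1)^{\binom n2}\frac{1}{n!}\omega^n$, $n=\dim_{\mathbb{C}}M$, where $M$ is oriented so that $\Omega$ is positive. Coherent vectors: let $L_0$ be the total space of $L$ with the zero section removed. For $q\in L_0$ define a linear form $\hat q$ on $\Gamma_{hol}(M,L)$ by $s(\pi(q))=\hat q(s)\,q$. The coherent vector $e_q\in\Gamma_{hol}(M,L)$ is the unique section with $\langle e_q,s\rangle=\hat q(s)$ for all $s\in\Gamma_{hol}(M,L)$. One has $e_{cq}=\bar c^{-1}e_q$ for $c\in\mathbb{C}^*$, so the three-point function does not depend on the choice of $q,q',q''\in L_0$ over $x,y,z$. Coherent state embedding: fix an orthonormal basis $s_0,\dots,s_N$ of $\Gamma_{hol}(M,L)$;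 then $i(x)=(s_0(x):\cdots:s_N(x))$. Projective space: $\mathbb{P}^N(\mathbb{C})$ carries the Fubini-Study Kähler form $$\omega_{FS}=\mathrm{i}\,\frac{(1+\|w\|^2)\sum_{j}dw_j\wedge d\bar w_j-\sum_{j,k}\bar w_jw_k\,dw_j\wedge d\bar w_k}{(1+\|w\|^2)^2}$$ in affine coordinates $w_j=z_j/z_0$. The Cayley distance, i.e. the geodesic distance with respect to the Fubini-Study metric, is $d_C([u],[v])=\arccos\frac{|\langle u,v\rangle|}{\|u\|\|v\|}$. The (oriented) geodesic triangle $\sigma([u],[v],[w])$ with vertices $[u],[v],[w]$ is the surface swept out by the geodesics between the point $[w]$ and all points on the geodesic between $[u]$ and $[v]$. A deformation with fixed boundary is a deformed surface having the same boundary. *)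

theory Defs
  imports "HOL-Analysis.Analysis"
begin

section \<open>Complex calculus in coordinates\<close>

definition cinner :: "complex^'k::finite \<Rightarrow> complex^'k \<Rightarrow> complex" where
  "cinner u v = (\<Sum>j\<in>UNIV. cnj (u $ j) * v $ j)"

definition holomorphic_fun :: "(complex^'n::finite) set \<Rightarrow> (complex^'n \<Rightarrow> complex) \<Rightarrow> bool" where
  "holomorphic_fun S f \<longleftrightarrow>
     (\<forall>z\<in>S. \<exists>D. (f has_derivative D) (at z) \<and> (\<forall>a v. D (a *s v) = a * D v))"

definition holomorphic_vec ::
    "(complex^'n::finite) set \<Rightarrow> (complex^'n \<Rightarrow> complex^'k::finite) \<Rightarrow> bool" where
  "holomorphic_vec S f \<longleftrightarrow> (\<forall>j. holomorphic_fun S (\<lambda>z. f z $ j))"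

fun Ck_on :: "nat \<Rightarrow> 'a::euclidean_space set \<Rightarrow> ('a \<Rightarrow> real) \<Rightarrow> bool" where
  "Ck_on 0 S f \<longleftrightarrow> continuous_on S f"
| "Ck_on (Suc k) S f \<longleftrightarrow>
     (\<forall>x\<in>S. f differentiable (at x)) \<and>
     (\<forall>b\<in>Basis. Ck_on k S (\<lambda>x. frechet_derivative f (at x) b))"

definition smooth_on :: "'a::euclidean_space set \<Rightarrow> ('a \<Rightarrow> real) \<Rightarrow> bool" where
  "smooth_on S f \<longleftrightarrow> (\<forall>k. Ck_on k S f)"

text \<open>The Wirtinger derivatives with respect to \<open>z\<^sub>j\<close> and to the conjugate of \<open>z\<^sub>j\<close>;
  \<open>axis j 1\<close> and \<open>axis j \<i>\<close> are the real coordinate directions of \<open>x\<^sub>j\<close> and \<open>y\<^sub>j\<close>.\<close>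

definition wirt :: "'n::finite \<Rightarrow> (complex^'n \<Rightarrow> complex) \<Rightarrow> complex^'n \<Rightarrow> complex" where
  "wirt j f z =
     (frechet_derivative f (at z) (axis j 1) - \<i> * frechet_derivative f (at z) (axis j \<i>)) / 2"

definition wirt_bar :: "'n::finite \<Rightarrow> (complex^'n \<Rightarrow> complex) \<Rightarrow> complex^'n \<Rightarrow> complex" where
  "wirt_bar j f z =
     (frechet_derivative f (at z) (axis j 1) + \<i> * frechet_derivative f (at z) (axis j \<i>)) / 2"

definition jacobian ::
    "(complex^'n::finite \<Rightarrow> complex^'n) \<Rightarrow> complex^'n \<Rightarrow> complex^'n^'n" where
  "jacobian T z = (\<chi> r j. wirt j (\<lambda>w. T w $ r) z)"

text \<open>The value on the tangent vectors \<open>u\<close>, \<open>v\<close> of the (1,1)-form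
  \<open>\<i> \<Sum>\<^sub>j\<^sub>k G\<^sub>j\<^sub>k dz\<^sub>j \<and> d(cnj z\<^sub>k)\<close>. For hermitian \<open>G\<close> the form is real, so that taking the real
  part loses nothing.\<close>

definition form11 :: "complex^'n::finite^'n \<Rightarrow> complex^'n \<Rightarrow> complex^'n \<Rightarrow> real" where
  "form11 G u v =
     Re (\<i> * (\<Sum>j\<in>UNIV. \<Sum>k\<in>UNIV. G $ j $ k * (u $ j * cnj (v $ k) - v $ j * cnj (u $ k))))"

text \<open>The value of the \<open>n\<close>-fold wedge power of a real 2-form on the real basis
  \<open>\<partial>/\<partial>x\<^sub>1, \<partial>/\<partial>y\<^sub>1, \<dots>, \<partial>/\<partial>x\<^sub>n, \<partial>/\<partial>y\<^sub>n\<close>. The pair \<open>(j, False)\<close> stands for \<open>x\<^sub>j\<close> and \<open>(j, True)\<close> for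
  \<open>y\<^sub>j\<close>. The convention is \<open>(\<alpha> \<and> \<beta>)(u, v) = \<alpha>(u) \<beta>(v) - \<alpha>(v) \<beta>(u)\<close> for 1-forms, as in
  \<^const>\<open>form11\<close>.\<close>

definition real_dir :: "'n::finite \<times> bool \<Rightarrow> complex^'n" where
  "real_dir p = axis (fst p) (if snd p then \<i> else 1)"

definition top_power :: "(complex^'n::finite \<Rightarrow> complex^'n \<Rightarrow> real) \<Rightarrow> real" where
  "top_power \<alpha> =
     (\<Sum>p | p permutes (UNIV :: ('n \<times> bool) set).
        of_int (sign p) * (\<Prod>j\<in>UNIV. \<alpha> (real_dir (p (j, False))) (real_dir (p (j, True)))))
     / 2 ^ CARD('n)"


section \<open>Complex manifolds\<close>

text \<open>The underlying space of the manifold is the whole type \<open>'m\<close>; a chart is an open set together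
  with a coordinate map, which is relevant on that set only.\<close>

type_synonym ('m, 'n) chart = "'m set \<times> ('m \<Rightarrow> complex^'n)"
type_synonym ('m, 'n) atlas = "('m, 'n) chart set"

definition chart_inv :: "('m, 'n::finite) chart \<Rightarrow> complex^'n \<Rightarrow> 'm" where
  "chart_inv c = inv_into (fst c) (snd c)"

definition is_chart :: "('m::topological_space, 'n::finite) chart \<Rightarrow> bool" where
  "is_chart c \<longleftrightarrow>
     open (fst c) \<and> open (snd c ` fst c) \<and> inj_on (snd c) (fst c) \<and>
     continuous_on (fst c) (snd c) \<and> continuous_on (snd c ` fst c) (chart_inv c)"

definition transition ::
    "('m, 'n::finite) chart \<Rightarrow> ('m, 'n) chart \<Rightarrow> complex^'n \<Rightarrow> complex^'n" where
  "transition c d z = snd d (chart_inv c z)"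

definition complex_atlas :: "('m::topological_space, 'n::finite) atlas \<Rightarrow> bool" where
  "complex_atlas A \<longleftrightarrow>
     (\<forall>c\<in>A. is_chart c) \<and> (\<Union>c\<in>A. fst c) = UNIV \<and>
     (\<forall>c\<in>A. \<forall>d\<in>A. holomorphic_vec (snd c ` (fst c \<inter> fst d)) (transition c d))"

definition mfd_holomorphic_on ::
    "('m, 'n::finite) atlas \<Rightarrow> 'm set \<Rightarrow> ('m \<Rightarrow> complex) \<Rightarrow> bool" where
  "mfd_holomorphic_on A U f \<longleftrightarrow>
     (\<forall>c\<in>A. holomorphic_fun (snd c ` (fst c \<inter> U)) (\<lambda>z. f (chart_inv c z)))"

definition mfd_smooth_on :: "('m, 'n::finite) atlas \<Rightarrow> 'm set \<Rightarrow> ('m \<Rightarrow> real) \<Rightarrow> bool" where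
  "mfd_smooth_on A U f \<longleftrightarrow>
     (\<forall>c\<in>A. smooth_on (snd c ` (fst c \<inter> U)) (\<lambda>z. f (chart_inv c z)))"

text \<open>A (1,1)-form on the manifold is given by its coefficient matrix in every chart, as a
  function of the coordinates: in the chart \<open>c\<close> it is
  \<open>\<i> \<Sum>\<^sub>j\<^sub>k \<omega> c z $ j $ k dz\<^sub>j \<and> d(cnj z\<^sub>k)\<close>.\<close>

type_synonym ('m, 'n) form = "('m, 'n) chart \<Rightarrow> complex^'n \<Rightarrow> complex^'n^'n"

definition is_form11 :: "('m, 'n::finite) atlas \<Rightarrow> ('m, 'n) form \<Rightarrow> bool" where
  "is_form11 A \<omega> \<longleftrightarrow>
     (\<forall>c\<in>A. \<forall>j k. smooth_on (snd c ` fst c) (\<lambda>z. Re (\<omega> c z $ j $ k)) \<and>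
                  smooth_on (snd c ` fst c) (\<lambda>z. Im (\<omega> c z $ j $ k))) \<and>
     (\<forall>c\<in>A. \<forall>d\<in>A. \<forall>z\<in>snd c ` (fst c \<inter> fst d). \<forall>j k.
        \<omega> c z $ j $ k =
          (\<Sum>r\<in>UNIV. \<Sum>s\<in>UNIV. jacobian (transition c d) z $ r $ j *
             \<omega> d (transition c d z) $ r $ s * cnj (jacobian (transition c d) z $ s $ k)))"

text \<open>Hermitian coefficients mean that the form is real. The last clause says that the (2,1)-part of
  \<open>d\<omega>\<close> vanishes; its (1,2)-part is the complex conjugate.\<close>

definition kaehler_form :: "('m, 'n::finite) atlas \<Rightarrow> ('m, 'n) form \<Rightarrow> bool" where
  "kaehler_form A \<omega> \<longleftrightarrow>
     is_form11 A \<omega> \<and>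
     (\<forall>c\<in>A. \<forall>z\<in>snd c ` fst c.
        (\<forall>j k. \<omega> c z $ j $ k = cnj (\<omega> c z $ k $ j)) \<and>
        (\<forall>v. v \<noteq> 0 \<longrightarrow> Re (\<Sum>j\<in>UNIV. \<Sum>k\<in>UNIV. \<omega> c z $ j $ k * v $ j * cnj (v $ k)) > 0) \<and>
        (\<forall>l j k. wirt l (\<lambda>w. \<omega> c w $ j $ k) z = wirt j (\<lambda>w. \<omega> c w $ l $ k) z))"

text \<open>The coordinate density of \<open>\<Omega> = (-1)^(n choose 2) / n! \<omega>\<^sup>n\<close> with respect to Lebesgue measure;
  the absolute value expresses that the manifold is oriented so that \<open>\<Omega>\<close> is positive.\<close>

definition volume_density :: "('m, 'n::finite) form \<Rightarrow> ('m, 'n) chart \<Rightarrow> complex^'n \<Rightarrow> real" where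
  "volume_density \<omega> c z =
     \<bar>(-1) ^ (CARD('n) choose 2) / fact CARD('n) * top_power (form11 (\<omega> c z))\<bar>"

text \<open>The integral over a compact manifold is computed by cutting it into finitely many disjoint
  Borel pieces, each of them relatively compact in a chart domain. By the transformation formula the
  result does not depend on how the manifold is cut.\<close>

definition chart_dissection ::
    "('m::topological_space, 'n::finite) atlas \<Rightarrow> (('m, 'n) chart \<times> 'm set) set \<Rightarrow> bool" where
  "chart_dissection A D \<longleftrightarrow>
     finite D \<and> fst ` D \<subseteq> A \<and>
     (\<forall>(c, P)\<in>D. P \<in> sets borel \<and> (\<exists>K. compact K \<and> P \<subseteq> K \<and> K \<subseteq> fst c)) \<and>
     (\<forall>d\<in>D. \<forall>d'\<in>D. d \<noteq> d' \<longrightarrow> snd d \<inter> snd d' = {}) \<and>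
     (\<Union>d\<in>D. snd d) = UNIV"

definition volume_integral ::
    "('m::topological_space, 'n::finite) atlas \<Rightarrow> ('m, 'n) form \<Rightarrow> ('m \<Rightarrow> complex) \<Rightarrow> complex" where
  "volume_integral A \<omega> f =
     (\<Sum>(c, P)\<in>(SOME D. chart_dissection A D).
        LINT z : snd c ` P | lborel. of_real (volume_density \<omega> c z) * f (chart_inv c z))"


section \<open>Hermitian holomorphic line bundles\<close>

text \<open>The type \<open>'l\<close> is the total space. The operations are those of the fibres and are relevant
  within one fibre only. A local trivialisation is an open set \<open>U\<close> of the base together with the
  fibre coordinate \<open>\<tau>\<close> of the map \<open>q \<mapsto> (\<pi> q, \<tau> q)\<close> from the part of the total space over \<open>U\<close> to
  the product of \<open>U\<close> with the complex plane. The topology and the complex structure of the total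
  space are those for which these maps are biholomorphic, so they are not recorded separately.\<close>

record ('l, 'm) line_bundle =
  lb_proj :: "'l \<Rightarrow> 'm"
  lb_add :: "'l \<Rightarrow> 'l \<Rightarrow> 'l"
  lb_scale :: "complex \<Rightarrow> 'l \<Rightarrow> 'l"
  lb_trivs :: "('m set \<times> ('l \<Rightarrow> complex)) set"

definition fibre :: "('l, 'm) line_bundle \<Rightarrow> 'm \<Rightarrow> 'l set" where
  "fibre L x = {q. lb_proj L q = x}"

definition holomorphic_line_bundle ::
    "('m::topological_space, 'n::finite) atlas \<Rightarrow> ('l, 'm) line_bundle \<Rightarrow> bool" where
  "holomorphic_line_bundle A L \<longleftrightarrow>
     (\<Union>(U, \<tau>)\<in>lb_trivs L. U) = UNIV \<and>
     (\<forall>(U, \<tau>)\<in>lb_trivs L. open U \<and>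
        (\<forall>x\<in>U. bij_betw \<tau> (fibre L x) UNIV \<and>
           (\<forall>p\<in>fibre L x. \<forall>q\<in>fibre L x.
              lb_add L p q \<in> fibre L x \<and> \<tau> (lb_add L p q) = \<tau> p + \<tau> q) \<and>
           (\<forall>a. \<forall>q\<in>fibre L x. lb_scale L a q \<in> fibre L x \<and> \<tau> (lb_scale L a q) = a * \<tau> q))) \<and>
     (\<forall>(U, \<tau>)\<in>lb_trivs L. \<forall>(V, \<sigma>)\<in>lb_trivs L.
        \<exists>g. mfd_holomorphic_on A (U \<inter> V) g \<and>
            (\<forall>q. lb_proj L q \<in> U \<inter> V \<longrightarrow> \<sigma> q = g (lb_proj L q) * \<tau> q))"

text \<open>The total space with the zero section removed: \<open>lb_scale L 0 q\<close> is the zero of the fibre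
  through \<open>q\<close>.\<close>

definition nonzero_vectors :: "('l, 'm) line_bundle \<Rightarrow> 'l set" where
  "nonzero_vectors L = {q. lb_scale L 0 q \<noteq> q}"

definition hol_sections ::
    "('m, 'n::finite) atlas \<Rightarrow> ('l, 'm) line_bundle \<Rightarrow> ('m \<Rightarrow> 'l) set" where
  "hol_sections A L =
     {s. (\<forall>x. lb_proj L (s x) = x) \<and>
         (\<forall>(U, \<tau>)\<in>lb_trivs L. mfd_holomorphic_on A U (\<lambda>x. \<tau> (s x)))}"

text \<open>The holomorphic frame belonging to a trivialisation, and the local function representing the
  metric in it.\<close>

definition frame :: "('l, 'm) line_bundle \<Rightarrow> ('l \<Rightarrow> complex) \<Rightarrow> 'm \<Rightarrow> 'l" where
  "frame L \<tau> x = (THE e. lb_proj L e = x \<and> \<tau> e = 1)"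

definition local_metric ::
    "('l, 'm) line_bundle \<Rightarrow> ('l \<Rightarrow> 'l \<Rightarrow> complex) \<Rightarrow> ('l \<Rightarrow> complex) \<Rightarrow> 'm \<Rightarrow> real" where
  "local_metric L h \<tau> x = Re (h (frame L \<tau> x) (frame L \<tau> x))"

definition hermitian_metric ::
    "('m, 'n::finite) atlas \<Rightarrow> ('l, 'm) line_bundle \<Rightarrow> ('l \<Rightarrow> 'l \<Rightarrow> complex) \<Rightarrow> bool" where
  "hermitian_metric A L h \<longleftrightarrow>
     (\<forall>x. \<forall>p\<in>fibre L x. \<forall>q\<in>fibre L x.
        h q p = cnj (h p q) \<and>
        (\<forall>r\<in>fibre L x. h p (lb_add L q r) = h p q + h p r) \<and>
        (\<forall>a. h p (lb_scale L a q) = a * h p q) \<and>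
        (q \<in> nonzero_vectors L \<longrightarrow> Re (h q q) > 0)) \<and>
     (\<forall>(U, \<tau>)\<in>lb_trivs L. mfd_smooth_on A U (local_metric L h \<tau>))"

text \<open>The curvature condition \<open>F = -\<i> \<omega>\<close>, that is, \<open>\<omega>\<close> equals \<open>\<i>\<close> times the result of applying
  first \<open>\<partial>\<close> and then \<open>\<partial>bar\<close> to the logarithm of the local metric. The minus sign comes from
  \<open>d(cnj z\<^sub>k) \<and> dz\<^sub>j = - dz\<^sub>j \<and> d(cnj z\<^sub>k)\<close>.\<close>

definition quantum_line_bundle ::
    "('m::topological_space, 'n::finite) atlas \<Rightarrow> ('m, 'n) form \<Rightarrow> ('l, 'm) line_bundle \<Rightarrow>
     ('l \<Rightarrow> 'l \<Rightarrow> complex) \<Rightarrow> bool" where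
  "quantum_line_bundle A \<omega> L h \<longleftrightarrow>
     holomorphic_line_bundle A L \<and> hermitian_metric A L h \<and>
     (\<forall>(U, \<tau>)\<in>lb_trivs L. \<forall>c\<in>A. \<forall>z\<in>snd c ` (fst c \<inter> U). \<forall>j k.
        \<omega> c z $ j $ k =
          - wirt_bar k (wirt j (\<lambda>w. of_real (ln (local_metric L h \<tau> (chart_inv c w))))) z)"


section \<open>Coherent vectors and the three-point function\<close>

definition section_inner ::
    "('m::topological_space, 'n::finite) atlas \<Rightarrow> ('m, 'n) form \<Rightarrow> ('l \<Rightarrow> 'l \<Rightarrow> complex) \<Rightarrow>
     ('m \<Rightarrow> 'l) \<Rightarrow> ('m \<Rightarrow> 'l) \<Rightarrow> complex" where
  "section_inner A \<omega> h \<phi> \<psi> = volume_integral A \<omega> (\<lambda>x. h (\<phi> x) (\<psi> x))"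

definition section_norm ::
    "('m::topological_space, 'n::finite) atlas \<Rightarrow> ('m, 'n) form \<Rightarrow> ('l \<Rightarrow> 'l \<Rightarrow> complex) \<Rightarrow>
     ('m \<Rightarrow> 'l) \<Rightarrow> real" where
  "section_norm A \<omega> h \<phi> = sqrt (Re (section_inner A \<omega> h \<phi> \<phi>))"

definition qhat :: "('l, 'm) line_bundle \<Rightarrow> 'l \<Rightarrow> ('m \<Rightarrow> 'l) \<Rightarrow> complex" where
  "qhat L q s = (THE a. s (lb_proj L q) = lb_scale L a q)"

definition coherent_vector ::
    "('m::topological_space, 'n::finite) atlas \<Rightarrow> ('m, 'n) form \<Rightarrow> ('l, 'm) line_bundle \<Rightarrow>
     ('l \<Rightarrow> 'l \<Rightarrow> complex) \<Rightarrow> 'l \<Rightarrow> 'm \<Rightarrow> 'l" where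
  "coherent_vector A \<omega> L h q =
     (THE e. e \<in> hol_sections A L \<and>
             (\<forall>s\<in>hol_sections A L. section_inner A \<omega> h e s = qhat L q s))"

definition three_point ::
    "('m::topological_space, 'n::finite) atlas \<Rightarrow> ('m, 'n) form \<Rightarrow> ('l, 'm) line_bundle \<Rightarrow>
     ('l \<Rightarrow> 'l \<Rightarrow> complex) \<Rightarrow> 'l \<Rightarrow> 'l \<Rightarrow> 'l \<Rightarrow> complex" where
  "three_point A \<omega> L h q q' q'' =
     (let e = coherent_vector A \<omega> L h; ip = section_inner A \<omega> h; nrm = section_norm A \<omega> h
      in (ip (e q) (e q') * ip (e q') (e q'') * ip (e q'') (e q)) /
         of_real ((nrm (e q))\<^sup>2 * (nrm (e q'))\<^sup>2 * (nrm (e q''))\<^sup>2))"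

text \<open>The equation \<open>\<phi> = \<Sum>\<^sub>j a\<^sub>j b\<^sub>j\<close> between sections, expressed fibrewise: the forms \<open>qhat L q\<close>
  read off the coefficient of a section with respect to \<open>q\<close>.\<close>

definition section_combination ::
    "('l, 'm) line_bundle \<Rightarrow> ('k::finite \<Rightarrow> complex) \<Rightarrow> ('k \<Rightarrow> 'm \<Rightarrow> 'l) \<Rightarrow> ('m \<Rightarrow> 'l) \<Rightarrow> bool" where
  "section_combination L a b \<phi> \<longleftrightarrow>
     (\<forall>q\<in>nonzero_vectors L. qhat L q \<phi> = (\<Sum>j\<in>UNIV. a j * qhat L q (b j)))"

definition section_basis ::
    "('m, 'n::finite) atlas \<Rightarrow> ('l, 'm) line_bundle \<Rightarrow> ('k::finite \<Rightarrow> 'm \<Rightarrow> 'l) \<Rightarrow> bool" where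
  "section_basis A L b \<longleftrightarrow>
     range b \<subseteq> hol_sections A L \<and>
     (\<forall>\<phi>\<in>hol_sections A L. \<exists>!a. section_combination L a b \<phi>)"

definition orthonormal_section_basis ::
    "('m::topological_space, 'n::finite) atlas \<Rightarrow> ('m, 'n) form \<Rightarrow> ('l, 'm) line_bundle \<Rightarrow>
     ('l \<Rightarrow> 'l \<Rightarrow> complex) \<Rightarrow> ('k::finite \<Rightarrow> 'm \<Rightarrow> 'l) \<Rightarrow> bool" where
  "orthonormal_section_basis A \<omega> L h s \<longleftrightarrow>
     section_basis A L s \<and>
     (\<forall>j k. section_inner A \<omega> h (s j) (s k) = (if j = k then 1 else 0))"


section \<open>Complex projective space\<close>

text \<open>The points of the projective space are the lines in \<open>complex^'k\<close>, where \<open>'k\<close> is the index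
  type of the homogeneous coordinates; its dimension is \<open>CARD('k) - 1\<close>.\<close>

type_synonym 'k point = "(complex^'k) set"

definition proj_point :: "complex^'k::finite \<Rightarrow> 'k point" where
  "proj_point u = range (\<lambda>a. a *s u)"

definition proj_space :: "'k::finite point set" where
  "proj_space = proj_point ` {u. u \<noteq> 0}"

definition affine_domain :: "'k::finite \<Rightarrow> 'k point set" where
  "affine_domain k = {p \<in> proj_space. \<exists>u\<in>p. u $ k \<noteq> 0}"

text \<open>The affine coordinates \<open>w\<^sub>j = z\<^sub>j / z\<^sub>k\<close>; the constant coordinate \<open>w\<^sub>k = 1\<close> is kept.\<close>

definition affine_coord :: "'k::finite \<Rightarrow> 'k point \<Rightarrow> complex^'k" where
  "affine_coord k p = (THE w. w \<in> p \<and> w $ k = 1)"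

definition representative :: "'k::finite point \<Rightarrow> complex^'k" where
  "representative p = (SOME u. u \<in> p \<and> u \<noteq> 0)"

definition cayley_dist :: "'k::finite point \<Rightarrow> 'k point \<Rightarrow> real" where
  "cayley_dist p r =
     (let u = representative p; v = representative r
      in arccos (cmod (cinner u v) / (norm u * norm v)))"

text \<open>The matrix of the Fubini-Study form in the affine chart \<open>k\<close>. The sums in the usual formula
  run over the affine coordinates proper, so row and column \<open>k\<close> are zero.\<close>

definition fubini_study :: "'k::finite \<Rightarrow> complex^'k \<Rightarrow> complex^'k^'k" where
  "fubini_study k w =
     (let S = 1 + (\<Sum>j\<in>- {k}. (cmod (w $ j))\<^sup>2)
      in \<chi> j l. if j = k \<or> l = k then 0
                else (of_real S * (if j = l then 1 else 0) - cnj (w $ j) * w $ l) / of_real (S\<^sup>2))"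

text \<open>For compact \<open>'m\<close>, an injective holomorphic immersion is automatically a homeomorphism onto its
  image, hence an embedding.\<close>

definition holomorphic_embedding ::
    "('m, 'n::finite) atlas \<Rightarrow> ('m \<Rightarrow> 'k::finite point) \<Rightarrow> bool" where
  "holomorphic_embedding A F \<longleftrightarrow>
     range F \<subseteq> proj_space \<and> inj F \<and>
     (\<forall>c\<in>A. \<forall>k.
        let V = {z \<in> snd c ` fst c. F (chart_inv c z) \<in> affine_domain k};
            G = (\<lambda>z. affine_coord k (F (chart_inv c z)))
        in open V \<and> holomorphic_vec V G \<and> (\<forall>z\<in>V. inj (frechet_derivative G (at z))))"

text \<open>The map \<open>x \<mapsto> (b\<^sub>0(x) : \<dots> : b\<^sub>N(x))\<close>. The homogeneous coordinates are taken with respect to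
  any nonzero vector of the fibre; the point does not depend on that vector.\<close>

definition projective_map :: "('l, 'm) line_bundle \<Rightarrow> ('k::finite \<Rightarrow> 'm \<Rightarrow> 'l) \<Rightarrow> 'm \<Rightarrow> 'k point" where
  "projective_map L b x =
     (let q = (SOME q. q \<in> nonzero_vectors L \<and> lb_proj L q = x)
      in proj_point (\<chi> j. qhat L q (b j)))"

definition very_ample ::
    "'k::finite itself \<Rightarrow> ('m, 'n::finite) atlas \<Rightarrow> ('l, 'm) line_bundle \<Rightarrow> bool" where
  "very_ample _ A L \<longleftrightarrow>
     (\<exists>b :: 'k \<Rightarrow> 'm \<Rightarrow> 'l. section_basis A L b \<and> holomorphic_embedding A (projective_map L b))"


section \<open>Geodesic triangles and surface integrals\<close>

text \<open>Minimal geodesics, parametrised proportionally to arc length: \<^const>\<open>cayley_dist\<close> is the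
  geodesic distance of the Fubini-Study metric. Between points at distance less than \<open>\<pi>/2\<close> there is
  exactly one.\<close>

definition geodesic :: "'k::finite point \<Rightarrow> 'k point \<Rightarrow> (real \<Rightarrow> 'k point) \<Rightarrow> bool" where
  "geodesic p r \<gamma> \<longleftrightarrow>
     \<gamma> 0 = p \<and> \<gamma> 1 = r \<and> (\<forall>t\<in>{0..1}. \<gamma> t \<in> proj_space) \<and>
     (\<forall>s\<in>{0..1}. \<forall>t\<in>{0..1}. cayley_dist (\<gamma> s) (\<gamma> t) = \<bar>s - t\<bar> * cayley_dist p r)"

text \<open>The surface swept out by the geodesics from \<open>r\<close> to the points of the geodesic from \<open>p\<close> to \<open>q\<close>:
  the first parameter moves along the geodesic from \<open>p\<close> to \<open>q\<close>, the second one along the sweeping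
  geodesics, starting at \<open>r\<close>. The parameter square carries its standard orientation, which orients
  the triangle by (direction of \<open>pq\<close>, direction away from \<open>r\<close>). Beware that in this orientation the
  boundary is run through as \<open>p \<rightarrow> r \<rightarrow> q \<rightarrow> p\<close>. With the conventions above (scalar products
  conjugate linear in the first argument, \<open>\<langle>e\<^sub>q, s\<rangle> = qhat L q s\<close>) it is the integral for this
  orientation which is the phase of the three-point function of \<open>p\<close>, \<open>q\<close>, \<open>r\<close>; the opposite
  orientation gives the negative of the phase.\<close>

definition geodesic_triangle ::
    "'k::finite point \<Rightarrow> 'k point \<Rightarrow> 'k point \<Rightarrow> (real \<Rightarrow> real \<Rightarrow> 'k point) \<Rightarrow> bool" where
  "geodesic_triangle p q r \<sigma> \<longleftrightarrow>
     geodesic p q (\<lambda>s. \<sigma> s 1) \<and> (\<forall>s\<in>{0..1}. geodesic r (\<sigma> s 1) (\<sigma> s))"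

definition C1_surface :: "(real \<Rightarrow> real \<Rightarrow> 'k::finite point) \<Rightarrow> bool" where
  "C1_surface \<sigma> \<longleftrightarrow>
     (\<forall>x\<in>{0..1} \<times> {0..1}. \<exists>k V D. open V \<and> x \<in> V \<and>
        (\<forall>y\<in>V \<inter> {0..1} \<times> {0..1}.
           case_prod \<sigma> y \<in> affine_domain k \<and>
           ((\<lambda>y. affine_coord k (case_prod \<sigma> y)) has_derivative D y) (at y within {0..1} \<times> {0..1})) \<and>
        (\<forall>v. continuous_on (V \<inter> {0..1} \<times> {0..1}) (\<lambda>y. D y v)))"

text \<open>Surfaces with the same boundary as the geodesic triangle. If the geodesic from \<open>p\<close> to \<open>q\<close>
  contains a point at distance \<open>\<pi>/2\<close> from \<open>r\<close>, the sweeping geodesic to that point is not unique,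
  but the boundary of the triangle is.\<close>

definition triangle_deformation ::
    "'k::finite point \<Rightarrow> 'k point \<Rightarrow> 'k point \<Rightarrow> (real \<Rightarrow> real \<Rightarrow> 'k point) \<Rightarrow> bool" where
  "triangle_deformation p q r \<tau> \<longleftrightarrow>
     C1_surface \<tau> \<and>
     (\<exists>\<sigma>. geodesic_triangle p q r \<sigma> \<and>
        (\<forall>s\<in>{0..1}. \<forall>t\<in>{0..1}. s \<in> {0, 1} \<or> t \<in> {0, 1} \<longrightarrow> \<tau> s t = \<sigma> s t))"

text \<open>The integral of the Fubini-Study form over a parametrised surface, that is, of its pull-back
  over the oriented parameter square. The integrand is computed in any affine chart around the
  point; the local expressions agree on overlaps.\<close>

definition fubini_study_pullback :: "(real \<Rightarrow> real \<Rightarrow> 'k::finite point) \<Rightarrow> real \<Rightarrow> real \<Rightarrow> real" where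
  "fubini_study_pullback \<sigma> s t =
     (let k = (SOME k. \<sigma> s t \<in> affine_domain k)
      in form11 (fubini_study k (affine_coord k (\<sigma> s t)))
           (vector_derivative (\<lambda>s'. affine_coord k (\<sigma> s' t)) (at s within {0..1}))
           (vector_derivative (\<lambda>t'. affine_coord k (\<sigma> s t')) (at t within {0..1})))"

definition fubini_study_integral :: "(real \<Rightarrow> real \<Rightarrow> 'k::finite point) \<Rightarrow> real" where
  "fubini_study_integral \<sigma> =
     integral ({0..1} \<times> {0..1}) (\<lambda>(s, t). fubini_study_pullback \<sigma> s t)"

end

theory Submission
  imports Defs
begin

text \<open>In an orthonormal basis the coherent vectors have scalar products
  \<open>\<langle>e\<^sub>q, e\<^sub>q'\<rangle> = \<langle>u q', u q\<rangle>\<close>, where \<open>u q\<close> is a vector of homogeneous coordinates of \<open>i (\<pi> q)\<close>. The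
  three-point function is thus a cyclic product of scalar products, with modulus
  \<open>cos a cos b cos c\<close>, and only its phase is at issue. Attach to two points of the projective space
  the phase of the scalar product of fixed representatives. Along a geodesic shorter than \<open>\<pi>/2\<close>
  these phases multiply like a cocycle, by the equality case of the triangle inequality. On a fine
  grid in the parameter square the phases around the cells multiply to the phase around the
  boundary, which is that of the three-point function, while the phase of a cell of side \<open>d\<close> at \<open>x\<close>
  is \<open>d\<^sup>2\<close> times the pull-back of the Fubini-Study form at \<open>x\<close>, up to \<open>o(d\<^sup>2)\<close> uniformly. No
  continuous lift of the surface and no second derivatives are needed.\<close>

section \<open>Coherent vectors in an orthonormal basis\<close>

text \<open>For w1 = w + d x and w2 = w + d y the difference <w1,w2><w,w> - <w1,w><w,w2> is exactly
  d^2 (<x,y><w,w> - <x,w><w,y>): sesquilinearity removes the terms of order 0 and 1. Hence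
  convergence of first difference quotients already gives the phase to second order. Their base
  point moves with the cell, which calls for strict differentiability. The phase of a cell is
  compared with the exponential of the integral over the cell, not of d^2 times the form, so that
  the comparison factors multiply to the exponential of the whole integral. As all factors have
  modulus at most 1, the errors of the N^2 cells merely add up, and e/N^2 per cell gives e in all.
  The boundary needs no limit: the product along a geodesic edge is the same for every N. The sign
  comes from the coherent vectors, whose coefficients are conjugated coordinates: the three-point
  function of x, y, z belongs to the cycle z -> y -> x -> z, and this is how the boundary of the
  parameter square, with one edge collapsed to i(z), is run through counterclockwise.\<close>

lemma holomorphic_fun_imp_continuous_on:
  assumes "holomorphic_fun S f"
  shows "continuous_on S f"
  using assms unfolding holomorphic_fun_def
  by (metis continuous_at_imp_continuous_on has_derivative_continuous)

lemma holomorphic_fun_cong: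
  assumes "open S" "\<And>z. z \<in> S \<Longrightarrow> f z = g z" "holomorphic_fun S f"
  shows "holomorphic_fun S g"
  using assms unfolding holomorphic_fun_def by (metis has_derivative_transform_within_open)

lemma smooth_on_imp_continuous_on:
  assumes "smooth_on S f"
  shows "continuous_on S f"
  using assms unfolding smooth_on_def by (metis Ck_on.simps(1))

lemma holomorphic_fun_linear_combination:
  fixes f :: "'k::finite \<Rightarrow> complex^'n::finite \<Rightarrow> complex"
  assumes "\<And>j. holomorphic_fun S (f j)"
  shows "holomorphic_fun S (\<lambda>z. \<Sum>j\<in>UNIV. a j * f j z)"
  unfolding holomorphic_fun_def
proof
  fix z assume z: "z \<in> S"
  have "\<forall>j. \<exists>D. (f j has_derivative D) (at z) \<and> (\<forall>a v. D (a *s v) = a * D v)"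
    using assms z unfolding holomorphic_fun_def by blast
  then obtain D where D: "\<And>j. (f j has_derivative D j) (at z)"
    and lin: "\<And>j a v. D j (a *s v) = a * D j v"
    by metis
  have "((\<lambda>z. \<Sum>j\<in>UNIV. a j * f j z) has_derivative (\<lambda>v. \<Sum>j\<in>UNIV. a j * D j v)) (at z)"
    by (intro derivative_intros D)
  moreover have "(\<Sum>j\<in>UNIV. a j * D j (b *s v)) = b * (\<Sum>j\<in>UNIV. a j * D j v)" for b v
    by (simp add: lin sum_distrib_left mult.left_commute)
  ultimately show "\<exists>D. ((\<lambda>z. \<Sum>j\<in>UNIV. a j * f j z) has_derivative D) (at z) \<and>
      (\<forall>a v. D (a *s v) = a * D v)"
    by blast
qed

section \<open>Charts and dissections of a compact manifold\<close>

lemma is_chartD: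
  assumes "is_chart c"
  shows "open (fst c)" "open (snd c ` fst c)" "inj_on (snd c) (fst c)"
    "continuous_on (fst c) (snd c)" "continuous_on (snd c ` fst c) (chart_inv c)"
  using assms unfolding is_chart_def by auto

lemma chart_inv_chart [simp]:
  assumes "is_chart c" "m \<in> fst c"
  shows "chart_inv c (snd c m) = m"
  using is_chartD(3)[OF assms(1)] assms(2) by (simp add: chart_inv_def inv_into_f_f)

lemma chart_image_eq:
  assumes "is_chart c" "P \<subseteq> fst c"
  shows "snd c ` P = snd c ` fst c \<inter> chart_inv c -` P"
  using assms by (auto simp: image_iff subset_eq)

lemma open_chart_image:
  assumes "is_chart c" "open U"
  shows "open (snd c ` (fst c \<inter> U))"
proof -
  have "open (snd c ` fst c \<inter> chart_inv c -` (fst c \<inter> U))"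
    by (rule continuous_open_preimage[OF is_chartD(5)[OF assms(1)] is_chartD(2)[OF assms(1)]])
      (intro open_Int assms is_chartD(1)[OF assms(1)])
  then show ?thesis
    using chart_image_eq[OF assms(1), of "fst c \<inter> U"] by simp
qed

text \<open>Images of Borel sets need not be Borel in general; this one is a preimage under
  \<open>chart_inv c\<close>, which is continuous on an open set.\<close>

lemma chart_image_borel:
  assumes c: "is_chart c" and P: "P \<in> sets borel" "P \<subseteq> fst c"
  shows "snd c ` P \<in> sets borel"
proof -
  let ?O = "snd c ` fst c"
  have "chart_inv c \<in> measurable (restrict_space borel ?O) borel"
    by (rule borel_measurable_continuous_on_restrict[OF is_chartD(5)[OF c]])
  then have "chart_inv c -` P \<inter> space (restrict_space borel ?O) \<in> sets (restrict_space borel ?O)"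
    using P by (rule_tac measurable_sets)
  moreover have "?O \<inter> space borel \<in> sets borel"
    using is_chartD(2)[OF c] by simp
  ultimately have "chart_inv c -` P \<inter> ?O \<in> sets borel"
    by (simp add: sets_restrict_space_iff space_restrict_space)
  then show ?thesis
    by (simp add: chart_image_eq[OF c P(2)] Int_commute)
qed

text \<open>The open \<open>G\<close> serves the covering argument on the compact manifold; the
  compact \<open>K\<close> around it is the bound inside a chart domain that
  \<open>chart_dissection\<close> requires.\<close>

lemma chart_neighbourhood:
  assumes A: "complex_atlas A"
  shows "\<exists>c G K. c \<in> A \<and> open G \<and> m \<in> G \<and> compact K \<and> G \<subseteq> K \<and> K \<subseteq> fst c"
proof -
  obtain c where c: "c \<in> A" "m \<in> fst c"
    using A unfolding complex_atlas_def by blast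
  have ch: "is_chart c"
    using A c unfolding complex_atlas_def by blast
  obtain r where r: "r > 0" "cball (snd c m) r \<subseteq> snd c ` fst c"
    using is_chartD(2)[OF ch] c(2) by (metis image_eqI open_contains_cball)
  define K where "K = chart_inv c ` cball (snd c m) r"
  define G where "G = fst c \<inter> snd c -` ball (snd c m) r"
  have "compact K"
    unfolding K_def
    by (intro compact_continuous_image compact_cball continuous_on_subset[OF is_chartD(5)[OF ch] r(2)])
  moreover have "open G"
    unfolding G_def
    by (intro continuous_open_preimage is_chartD[OF ch] open_ball)
  moreover have "m \<in> G" using c r by (simp add: G_def)
  moreover have "G \<subseteq> K"
  proof
    fix g assume g: "g \<in> G"
    then have "g = chart_inv c (snd c g)" "snd c g \<in> cball (snd c m) r"
      using ch by (auto simp: G_def)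
    then show "g \<in> K" unfolding K_def by blast
  qed
  moreover have "K \<subseteq> fst c"
    using r(2) ch by (fastforce simp: K_def)
  ultimately show ?thesis using c by blast
qed

text \<open>\<open>volume_integral\<close> picks its dissection by \<open>SOME\<close>, so nothing
  can be computed before one is known to exist. A finite subcover by the sets \<open>G m\<close> is
  made disjoint.\<close>

lemma chart_dissection_exists:
  fixes A :: "('m::t2_space, 'n::finite) atlas"
  assumes comp: "compact (UNIV :: 'm set)" and A: "complex_atlas A"
  shows "\<exists>D. chart_dissection A D"
proof -
  obtain c :: "'m \<Rightarrow> ('m, 'n) chart" and G K
    where cGK: "\<And>m. c m \<in> A" "\<And>m. open (G m)" "\<And>m. m \<in> G m" "\<And>m. compact (K m)"
      "\<And>m. G m \<subseteq> K m" "\<And>m. K m \<subseteq> fst (c m)"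
    using chart_neighbourhood[OF A] by metis
  obtain X where X: "finite X" "UNIV \<subseteq> (\<Union>m\<in>X. G m)"
    using compactE_image[OF comp, of UNIV G] cGK(2,3) by (metis UNIV_I UN_I subsetI)
  obtain f where f: "bij_betw f {0..<card X} X"
    using ex_bij_betw_nat_finite[OF X(1)] by blast
  let ?n = "card X"
  let ?P = "disjointed (\<lambda>i. G (f i))"
  let ?D = "(\<lambda>i. (c (f i), ?P i)) ` {0..<?n}"
  have "range ?P \<subseteq> sets borel"
    by (intro sets.range_disjointed_sets) (use cGK in auto)
  then have "?P i \<in> sets borel" for i by auto
  moreover have "?P i \<subseteq> K (f i)" for i
    by (rule order_trans[OF disjointed_subset cGK(5)])
  moreover have "(\<Union>i\<in>{0..<?n}. ?P i) = UNIV"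
  proof -
    have "(\<Union>m\<in>f ` {0..<?n}. G m) = UNIV"
      unfolding bij_betw_imp_surj_on[OF f] using X(2) by (rule top.extremum_uniqueI)
    then show ?thesis
      unfolding finite_UN_disjointed_eq image_image .
  qed
  moreover have "?P i \<inter> ?P j = {}" if "i \<noteq> j" for i j
    using disjoint_family_disjointed[of "\<lambda>i. G (f i)"] that unfolding disjoint_family_on_def by auto
  ultimately have sets: "\<And>i. ?P i \<in> sets borel" and sub: "\<And>i. ?P i \<subseteq> K (f i)"
    and un: "(\<Union>i\<in>{0..<?n}. ?P i) = UNIV" and disj: "\<And>i j. i \<noteq> j \<Longrightarrow> ?P i \<inter> ?P j = {}"
    by blast+
  have "chart_dissection A ?D"
    unfolding chart_dissection_def
  proof (intro conjI ballI)
    show "finite ?D" by simp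
    show "fst ` ?D \<subseteq> A" using cGK(1) by auto
    show "(\<Union>d\<in>?D. snd d) = UNIV" using un by simp
  next
    fix d assume "d \<in> ?D"
    then obtain i where d: "d = (c (f i), ?P i)" by blast
    show "case d of (c, P) \<Rightarrow> P \<in> sets borel \<and> (\<exists>K. compact K \<and> P \<subseteq> K \<and> K \<subseteq> fst c)"
      unfolding d case_prod_conv using sets[of i] sub[of i] cGK(4,6)[of "f i"] by blast
  next
    fix d d' assume "d \<in> ?D" "d' \<in> ?D"
    then obtain i j where d: "d = (c (f i), ?P i)" "d' = (c (f j), ?P j)" by blast
    then show "d \<noteq> d' \<longrightarrow> snd d \<inter> snd d' = {}"
      using disj[of i j] by (cases "i = j") simp_all
  qed
  then show ?thesis by blast
qed

lemma continuous_on_volume_density: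
  assumes "is_form11 A \<omega>" "c \<in> A"
  shows "continuous_on (snd c ` fst c) (volume_density \<omega> c)"
proof -
  have "continuous_on (snd c ` fst c) (\<lambda>z. Complex (Re (\<omega> c z $ j $ k)) (Im (\<omega> c z $ j $ k)))" for j k
    using assms unfolding is_form11_def
    by (intro continuous_on_Complex) (auto intro!: smooth_on_imp_continuous_on)
  then have "continuous_on (snd c ` fst c) (\<lambda>z. \<chi> j k. \<omega> c z $ j $ k)"
    by (intro continuous_on_vec_lambda) simp
  then have "continuous_on (snd c ` fst c) (\<omega> c)"
    by simp
  then show ?thesis
    unfolding volume_density_def[abs_def] top_power_def form11_def
    by (intro continuous_intros) auto
qed

text \<open>The choice in \<open>volume_integral\<close> does not depend on the integrand, so all
  integrals use the same \<open>D\<close> and linearity can be checked on each piece. A piece lies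
  in a compact set on which the integrand is continuous, hence integrable.\<close>

lemma volume_integral_linear_combination:
  fixes A :: "('m::t2_space, 'n::finite) atlas" and f :: "'k::finite \<Rightarrow> 'm \<Rightarrow> complex"
  assumes comp: "compact (UNIV :: 'm set)" and A: "complex_atlas A" and \<omega>: "is_form11 A \<omega>"
    and f: "\<And>j c. c \<in> A \<Longrightarrow> continuous_on (snd c ` fst c) (\<lambda>z. f j (chart_inv c z))"
  shows "volume_integral A \<omega> (\<lambda>x. \<Sum>j\<in>UNIV. a j * f j x) =
           (\<Sum>j\<in>UNIV. a j * volume_integral A \<omega> (f j))"
proof -
  define D where "D = (SOME D. chart_dissection A D)"
  have D: "chart_dissection A D"
    unfolding D_def using chart_dissection_exists[OF comp A] by (rule someI_ex)
  let ?I = "\<lambda>c P g. LINT z : snd c ` P | lborel. of_real (volume_density \<omega> c z) * g (chart_inv c z)"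
  have "?I c P (\<lambda>x. \<Sum>j\<in>UNIV. a j * f j x) = (\<Sum>j\<in>UNIV. a j * ?I c P (f j))"
    if cP: "(c, P) \<in> D" for c P
  proof -
    have pieces: "\<forall>(c, P)\<in>D. P \<in> sets borel \<and> (\<exists>K. compact K \<and> P \<subseteq> K \<and> K \<subseteq> fst c)"
      using D unfolding chart_dissection_def by (elim conjE)
    have "fst ` D \<subseteq> A"
      using D unfolding chart_dissection_def by (elim conjE)
    then have cA: "c \<in> A"
      using cP by force
    then have ch: "is_chart c"
      using A unfolding complex_atlas_def by blast
    obtain K where K: "P \<in> sets borel" "compact K" "P \<subseteq> K" "K \<subseteq> fst c"
      using bspec[OF pieces cP] by auto
    have int: "set_integrable lborel (snd c ` P) (\<lambda>z. of_real (volume_density \<omega> c z) * f j (chart_inv c z))"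
      for j
    proof (rule set_integrable_subset)
      have "continuous_on (snd c ` fst c) (\<lambda>z. of_real (volume_density \<omega> c z) * f j (chart_inv c z))"
        by (intro continuous_intros continuous_on_volume_density[OF \<omega> cA] f cA)
      then have "continuous_on (snd c ` K) (\<lambda>z. of_real (volume_density \<omega> c z) * f j (chart_inv c z))"
        by (rule continuous_on_subset) (use K in blast)
      moreover have "compact (snd c ` K)"
        using compact_continuous_image[OF continuous_on_subset[OF is_chartD(4)[OF ch] K(4)] K(2)] .
      ultimately show "set_integrable lborel (snd c ` K) (\<lambda>z. of_real (volume_density \<omega> c z) * f j (chart_inv c z))"
        unfolding set_integrable_def by (intro borel_integrable_compact)
      show "snd c ` P \<in> sets lborel"
        using chart_image_borel[OF ch K(1)] K by auto
    qed (use K in blast)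
    have "?I c P (\<lambda>x. \<Sum>j\<in>UNIV. a j * f j x) =
        (LINT z|lborel. (\<Sum>j\<in>UNIV. a j * (indicator (snd c ` P) z *\<^sub>R
          (of_real (volume_density \<omega> c z) * f j (chart_inv c z)))))"
      unfolding set_lebesgue_integral_def
      by (intro Bochner_Integration.integral_cong refl)
        (simp add: sum_distrib_left scaleR_sum_right mult_ac)
    also have "\<dots> = (\<Sum>j\<in>UNIV. a j * ?I c P (f j))"
      using int unfolding set_integrable_def set_lebesgue_integral_def
      by (subst Bochner_Integration.integral_sum) (auto simp del: mult_scaleR_right)
    finally show ?thesis .
  qed
  then have "volume_integral A \<omega> (\<lambda>x. \<Sum>j\<in>UNIV. a j * f j x) =
      (\<Sum>(c, P)\<in>D. \<Sum>j\<in>UNIV. a j * ?I c P (f j))"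
    unfolding volume_integral_def D_def[symmetric] by (intro sum.cong) auto
  also have "\<dots> = (\<Sum>j\<in>UNIV. a j * volume_integral A \<omega> (f j))"
    unfolding volume_integral_def D_def[symmetric] sum_distrib_left case_prod_unfold
    by (rule sum.swap)
  finally show ?thesis .
qed

section \<open>Trivialisations and holomorphic sections\<close>

lemma trivialisation_exists:
  assumes "holomorphic_line_bundle A L"
  obtains U \<tau> where "(U, \<tau>) \<in> lb_trivs L" "x \<in> U"
proof -
  have "x \<in> (\<Union>(U, \<tau>)\<in>lb_trivs L. U)"
    using assms unfolding holomorphic_line_bundle_def by simp
  then show thesis using that by blast
qed

lemma trivialisationD:
  assumes "holomorphic_line_bundle A L" "(U, \<tau>) \<in> lb_trivs L"
  shows "open U"
    and "\<And>x. x \<in> U \<Longrightarrow> bij_betw \<tau> (fibre L x) UNIV"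
    and "\<And>p r. lb_proj L p \<in> U \<Longrightarrow> lb_proj L p = lb_proj L r \<Longrightarrow> \<tau> p = \<tau> r \<Longrightarrow> p = r"
    and "\<And>a p. lb_proj L p \<in> U \<Longrightarrow> lb_proj L (lb_scale L a p) = lb_proj L p"
    and "\<And>a p. lb_proj L p \<in> U \<Longrightarrow> \<tau> (lb_scale L a p) = a * \<tau> p"
proof -
  have *: "open U \<and>
        (\<forall>x\<in>U. bij_betw \<tau> (fibre L x) UNIV \<and>
           (\<forall>a. \<forall>q\<in>fibre L x. lb_scale L a q \<in> fibre L x \<and> \<tau> (lb_scale L a q) = a * \<tau> q))"
    using assms unfolding holomorphic_line_bundle_def by blast
  then show "open U" and bij: "\<And>x. x \<in> U \<Longrightarrow> bij_betw \<tau> (fibre L x) UNIV" by auto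
  show "\<And>a p. lb_proj L p \<in> U \<Longrightarrow> lb_proj L (lb_scale L a p) = lb_proj L p"
    and "\<And>a p. lb_proj L p \<in> U \<Longrightarrow> \<tau> (lb_scale L a p) = a * \<tau> p"
    using * by (auto simp: fibre_def)
  show "p = r" if "lb_proj L p \<in> U" "lb_proj L p = lb_proj L r" "\<tau> p = \<tau> r" for p r
    using bij[OF that(1)] that unfolding bij_betw_def inj_on_def fibre_def by auto
qed

lemma trivialisation_transition:
  assumes L: "holomorphic_line_bundle A L" "(U, \<tau>) \<in> lb_trivs L" "(V, \<sigma>) \<in> lb_trivs L"
  obtains g where "\<And>q. lb_proj L q \<in> U \<inter> V \<Longrightarrow> \<sigma> q = g (lb_proj L q) * \<tau> q"
proof -
  have "\<forall>(U, \<tau>)\<in>lb_trivs L. \<forall>(V, \<sigma>)\<in>lb_trivs L.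
        \<exists>g. mfd_holomorphic_on A (U \<inter> V) g \<and>
            (\<forall>q. lb_proj L q \<in> U \<inter> V \<longrightarrow> \<sigma> q = g (lb_proj L q) * \<tau> q)"
    using L(1) unfolding holomorphic_line_bundle_def by (elim conjE)
  from bspec[OF this L(2), unfolded case_prod_conv, THEN bspec, OF L(3), unfolded case_prod_conv]
  show thesis using that by blast
qed

lemma trivialisation_surj:
  assumes "holomorphic_line_bundle A L" "(U, \<tau>) \<in> lb_trivs L" "x \<in> U"
  obtains p where "lb_proj L p = x" "\<tau> p = a"
proof -
  have "a \<in> \<tau> ` fibre L x"
    using bij_betw_imp_surj_on[OF trivialisationD(2)[OF assms]] by simp
  then show thesis using that unfolding fibre_def by blast
qed

lemma nonzero_vectors_iff:
  assumes "holomorphic_line_bundle A L" "(U, \<tau>) \<in> lb_trivs L" "lb_proj L q \<in> U"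
  shows "q \<in> nonzero_vectors L \<longleftrightarrow> \<tau> q \<noteq> 0"
proof -
  note T = trivialisationD(3-5)[OF assms(1,2)]
  have "lb_scale L 0 q = q" if "\<tau> q = 0"
    using that assms(3) by (intro T(1)) (simp_all add: T(2,3))
  moreover have "\<tau> (lb_scale L 0 q) = 0"
    using T(3)[OF assms(3), of 0] by simp
  ultimately show ?thesis
    unfolding nonzero_vectors_def by auto
qed

lemma nonzero_vector_exists:
  assumes "holomorphic_line_bundle A L"
  obtains q where "q \<in> nonzero_vectors L" "lb_proj L q = x"
proof -
  obtain U \<tau> where U: "(U, \<tau>) \<in> lb_trivs L" "x \<in> U"
    using trivialisation_exists[OF assms] by blast
  obtain p where p: "lb_proj L p = x" "\<tau> p = 1"
    using trivialisation_surj[OF assms U] by blast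
  show thesis
    using that[of p] nonzero_vectors_iff[OF assms U(1), of p] U(2) p by simp
qed

lemma qhat_eq:
  assumes L: "holomorphic_line_bundle A L" "(U, \<tau>) \<in> lb_trivs L" "lb_proj L q \<in> U"
    and q: "q \<in> nonzero_vectors L" and s: "\<And>x. lb_proj L (s x) = x"
  shows "qhat L q s = \<tau> (s (lb_proj L q)) / \<tau> q"
  unfolding qhat_def
proof (rule the_equality)
  note T = trivialisationD(3-5)[OF L(1,2)]
  have nz: "\<tau> q \<noteq> 0"
    using nonzero_vectors_iff[OF L] q by blast
  show "s (lb_proj L q) = lb_scale L (\<tau> (s (lb_proj L q)) / \<tau> q) q"
    using L(3) nz s by (intro T(1)) (simp_all add: T(2,3))
  show "a = \<tau> (s (lb_proj L q)) / \<tau> q" if "s (lb_proj L q) = lb_scale L a q" for a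
    using L(3) nz that by (simp add: T(3))
qed

lemma hol_sections_proj:
  assumes "s \<in> hol_sections A L"
  shows "lb_proj L (s x) = x"
  using assms unfolding hol_sections_def by blast

lemma hol_sections_holomorphic:
  assumes "s \<in> hol_sections A L" "(U, \<tau>) \<in> lb_trivs L" "c \<in> A"
  shows "holomorphic_fun (snd c ` (fst c \<inter> U)) (\<lambda>z. \<tau> (s (chart_inv c z)))"
  using assms by (auto simp: hol_sections_def mfd_holomorphic_on_def)

lemma local_metric_smooth:
  assumes "hermitian_metric A L h" "(U, \<tau>) \<in> lb_trivs L" "c \<in> A"
  shows "smooth_on (snd c ` (fst c \<inter> U)) (\<lambda>z. local_metric L h \<tau> (chart_inv c z))"
proof -
  have "\<forall>(U, \<tau>)\<in>lb_trivs L. mfd_smooth_on A U (local_metric L h \<tau>)"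
    using assms(1) unfolding hermitian_metric_def by (elim conjE)
  from bspec[OF this assms(2), unfolded case_prod_conv] show ?thesis
    using assms(3) unfolding mfd_smooth_on_def by blast
qed

text \<open>Dividing by \<open>\<tau> q\<close> turns fibre coordinates into values of
  \<open>qhat L q\<close>, and this common factor drops out of a linear equation.\<close>

lemma section_combination_iff:
  assumes L: "holomorphic_line_bundle A L"
    and \<phi>: "\<And>x. lb_proj L (\<phi> x) = x" and b: "\<And>j x. lb_proj L (b j x) = x"
  shows "section_combination L a b \<phi> \<longleftrightarrow>
    (\<forall>(U, \<tau>)\<in>lb_trivs L. \<forall>x\<in>U. \<tau> (\<phi> x) = (\<Sum>j\<in>UNIV. a j * \<tau> (b j x)))"
proof -
  have *: "qhat L q \<phi> = (\<Sum>j\<in>UNIV. a j * qhat L q (b j)) \<longleftrightarrow>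
      \<tau> (\<phi> (lb_proj L q)) = (\<Sum>j\<in>UNIV. a j * \<tau> (b j (lb_proj L q)))"
    if "q \<in> nonzero_vectors L" "(U, \<tau>) \<in> lb_trivs L" "lb_proj L q \<in> U" for q U \<tau>
    using nonzero_vectors_iff[OF L that(2,3)] that
    by (simp add: qhat_eq[OF L that(2,3,1)] \<phi> b sum_divide_distrib[symmetric])
  show ?thesis
  proof
    assume c: "section_combination L a b \<phi>"
    show "\<forall>(U, \<tau>)\<in>lb_trivs L. \<forall>x\<in>U. \<tau> (\<phi> x) = (\<Sum>j\<in>UNIV. a j * \<tau> (b j x))"
    proof (intro ballI case_prodI2)
      fix V U \<tau> x assume "V \<in> lb_trivs L" "V = (U, \<tau>)" and x: "x \<in> U"
      then have U: "(U, \<tau>) \<in> lb_trivs L" by simp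
      obtain q where q: "q \<in> nonzero_vectors L" "lb_proj L q = x"
        using nonzero_vector_exists[OF L] by blast
      have "qhat L q \<phi> = (\<Sum>j\<in>UNIV. a j * qhat L q (b j))"
        using c q(1) unfolding section_combination_def by blast
      then show "\<tau> (\<phi> x) = (\<Sum>j\<in>UNIV. a j * \<tau> (b j x))"
        using *[OF q(1) U] x q(2) by simp
    qed
  next
    assume c: "\<forall>(U, \<tau>)\<in>lb_trivs L. \<forall>x\<in>U. \<tau> (\<phi> x) = (\<Sum>j\<in>UNIV. a j * \<tau> (b j x))"
    show "section_combination L a b \<phi>"
      unfolding section_combination_def
    proof
      fix q assume q: "q \<in> nonzero_vectors L"
      obtain U \<tau> where U: "(U, \<tau>) \<in> lb_trivs L" "lb_proj L q \<in> U"
        using trivialisation_exists[OF L] by blast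
      then show "qhat L q \<phi> = (\<Sum>j\<in>UNIV. a j * qhat L q (b j))"
        using *[OF q U] c by blast
    qed
  qed
qed

lemma section_combination_unique:
  assumes L: "holomorphic_line_bundle A L"
    and \<phi>: "\<And>x. lb_proj L (\<phi> x) = x" and \<psi>: "\<And>x. lb_proj L (\<psi> x) = x"
    and b: "\<And>j x. lb_proj L (b j x) = x"
    and "section_combination L a b \<phi>" "section_combination L a b \<psi>"
  shows "\<phi> = \<psi>"
proof
  fix x
  obtain U \<tau> where U: "(U, \<tau>) \<in> lb_trivs L" "x \<in> U"
    using trivialisation_exists[OF L] by blast
  have "\<tau> (\<phi> x) = \<tau> (\<psi> x)"
    using assms(5,6) U
    unfolding section_combination_iff[OF L \<phi> b] section_combination_iff[OF L \<psi> b] by fastforce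
  then show "\<phi> x = \<psi> x"
    using trivialisationD(3)[OF L U(1)] U(2) \<phi> \<psi> by simp
qed

text \<open>At each point the combination is formed in one trivialisation; any other one multiplies
  both sides by the same transition factor, so the equation holds in all of them. Holomorphy can
  then be read off in every trivialisation.\<close>

lemma section_combination_exists:
  assumes A: "complex_atlas A" and L: "holomorphic_line_bundle A L"
    and b: "\<And>j. b j \<in> hol_sections A L"
  obtains \<phi> where "\<phi> \<in> hol_sections A L" "section_combination L a b \<phi>"
proof -
  have bp: "lb_proj L (b j x) = x" for j x
    using hol_sections_proj[OF b] .
  have "\<exists>p. lb_proj L p = x \<and> (\<forall>(U, \<tau>)\<in>lb_trivs L. x \<in> U \<longrightarrow> \<tau> p = (\<Sum>j\<in>UNIV. a j * \<tau> (b j x)))" for x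
  proof -
    obtain U \<tau> where U: "(U, \<tau>) \<in> lb_trivs L" "x \<in> U"
      using trivialisation_exists[OF L] by blast
    obtain p where p: "lb_proj L p = x" "\<tau> p = (\<Sum>j\<in>UNIV. a j * \<tau> (b j x))"
      using trivialisation_surj[OF L U] by blast
    have "\<sigma> p = (\<Sum>j\<in>UNIV. a j * \<sigma> (b j x))" if V: "(V, \<sigma>) \<in> lb_trivs L" "x \<in> V" for V \<sigma>
    proof -
      obtain g where "\<And>q. lb_proj L q \<in> U \<inter> V \<Longrightarrow> \<sigma> q = g (lb_proj L q) * \<tau> q"
        using trivialisation_transition[OF L U(1) V(1)] by blast
      then have g: "\<sigma> q = g x * \<tau> q" if "lb_proj L q = x" for q
        using U(2) V(2) that by simp
      show ?thesis
        by (simp add: g p bp sum_distrib_left mult.left_commute)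
    qed
    then show ?thesis using p(1) by blast
  qed
  then have "\<exists>\<phi>. \<forall>x. lb_proj L (\<phi> x) = x \<and>
      (\<forall>(U, \<tau>)\<in>lb_trivs L. x \<in> U \<longrightarrow> \<tau> (\<phi> x) = (\<Sum>j\<in>UNIV. a j * \<tau> (b j x)))"
    by (intro choice allI)
  then obtain \<phi> where \<phi>: "\<And>x. lb_proj L (\<phi> x) = x"
    "\<And>U \<tau> x. (U, \<tau>) \<in> lb_trivs L \<Longrightarrow> x \<in> U \<Longrightarrow> \<tau> (\<phi> x) = (\<Sum>j\<in>UNIV. a j * \<tau> (b j x))"
    by blast
  have "mfd_holomorphic_on A U (\<lambda>x. \<tau> (\<phi> x))" if U: "(U, \<tau>) \<in> lb_trivs L" for U \<tau>
    unfolding mfd_holomorphic_on_def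
  proof
    fix c assume c: "c \<in> A"
    then have ch: "is_chart c" using A unfolding complex_atlas_def by blast
    let ?S = "snd c ` (fst c \<inter> U)"
    have "holomorphic_fun ?S (\<lambda>z. \<tau> (b j (chart_inv c z)))" for j
      by (rule hol_sections_holomorphic[OF b U c])
    then have "holomorphic_fun ?S (\<lambda>z. \<Sum>j\<in>UNIV. a j * \<tau> (b j (chart_inv c z)))"
      by (rule holomorphic_fun_linear_combination)
    moreover have "open ?S"
      using open_chart_image[OF ch] trivialisationD(1)[OF L U] by blast
    ultimately show "holomorphic_fun ?S (\<lambda>z. \<tau> (\<phi> (chart_inv c z)))"
      by (rule holomorphic_fun_cong[rotated 2]) (use ch in \<open>auto simp: \<phi>(2)[OF U]\<close>)
  qed
  then have "\<phi> \<in> hol_sections A L"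
    using \<phi>(1) unfolding hol_sections_def by auto
  moreover have "section_combination L a b \<phi>"
    unfolding section_combination_iff[OF L \<phi>(1) bp] using \<phi>(2) by auto
  ultimately show thesis by (rule that)
qed

section \<open>The scalar product of sections and the coherent vectors\<close>

lemma hermitian_metric_eq:
  assumes L: "holomorphic_line_bundle A L" "(U, \<tau>) \<in> lb_trivs L" "x \<in> U"
    and h: "hermitian_metric A L h" and p: "lb_proj L p = x" and r: "lb_proj L r = x"
  shows "h p r = cnj (\<tau> p) * \<tau> r * of_real (local_metric L h \<tau> x)"
proof -
  note T = trivialisationD(3-5)[OF L(1,2)]
  define e where "e = frame L \<tau> x"
  obtain e' where e': "lb_proj L e' = x" "\<tau> e' = 1"
    using trivialisation_surj[OF L] by blast
  have "e = e'"
    unfolding e_def frame_def using e' L(3) T(1) by (intro the_equality) auto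
  then have e: "lb_proj L e = x" "\<tau> e = 1" using e' by auto
  have sc: "v = lb_scale L (\<tau> v) e" if "lb_proj L v = x" for v
    using that e L(3) by (intro T(1)) (simp_all add: T(2,3))
  have cn: "h w v = cnj (h v w)" if "lb_proj L v = x" "lb_proj L w = x" for v w
    using h that unfolding hermitian_metric_def fibre_def by blast
  have lin: "h v (lb_scale L a w) = a * h v w" if "lb_proj L v = x" "lb_proj L w = x" for v w a
    using h that unfolding hermitian_metric_def fibre_def by blast
  have "h p r = \<tau> r * h p e"
    using sc[OF r] lin[OF p e(1)] by metis
  also have "h p e = cnj (h e p)"
    using cn[OF e(1) p] .
  also have "h e p = \<tau> p * h e e"
    using sc[OF p] lin[OF e(1) e(1)] by metis
  also have "h e e = of_real (local_metric L h \<tau> x)"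
    using cn[OF e(1) e(1)] unfolding local_metric_def e_def[symmetric]
    by (simp add: complex_eq_iff)
  finally show ?thesis by simp
qed

lemma continuous_on_metric_of_sections:
  assumes A: "complex_atlas A" and L: "holomorphic_line_bundle A L" and h: "hermitian_metric A L h"
    and \<phi>: "\<phi> \<in> hol_sections A L" and \<psi>: "\<psi> \<in> hol_sections A L" and c: "c \<in> A"
  shows "continuous_on (snd c ` fst c) (\<lambda>z. h (\<phi> (chart_inv c z)) (\<psi> (chart_inv c z)))"
proof -
  let ?f = "\<lambda>z. h (\<phi> (chart_inv c z)) (\<psi> (chart_inv c z))"
  have ch: "is_chart c" using A c unfolding complex_atlas_def by blast
  have "isCont ?f z" if z: "z \<in> snd c ` fst c" for z
  proof -
    obtain U \<tau> where U: "(U, \<tau>) \<in> lb_trivs L" "chart_inv c z \<in> U"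
      using trivialisation_exists[OF L] by blast
    let ?S = "snd c ` (fst c \<inter> U)"
    have zS: "z \<in> ?S"
      using z U(2) ch by force
    have S: "open ?S"
      using open_chart_image[OF ch] trivialisationD(1)[OF L U(1)] by blast
    have hol: "continuous_on ?S (\<lambda>z. \<tau> (t (chart_inv c z)))" if "t \<in> hol_sections A L" for t
      by (intro holomorphic_fun_imp_continuous_on hol_sections_holomorphic[OF that U(1) c])
    have "continuous_on ?S (\<lambda>z. local_metric L h \<tau> (chart_inv c z))"
      by (rule smooth_on_imp_continuous_on[OF local_metric_smooth[OF h U(1) c]])
    then have "continuous_on ?S (\<lambda>z. cnj (\<tau> (\<phi> (chart_inv c z))) * \<tau> (\<psi> (chart_inv c z)) *
        of_real (local_metric L h \<tau> (chart_inv c z)))"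
      by (intro continuous_intros hol \<phi> \<psi>)
    then have "continuous_on ?S ?f"
      by (rule continuous_on_eq)
        (use ch U in \<open>auto simp: hermitian_metric_eq[OF L U(1) _ h] hol_sections_proj[OF \<phi>]
           hol_sections_proj[OF \<psi>]\<close>)
    then show ?thesis
      by (rule continuous_on_interior) (simp add: interior_open[OF S] zS)
  qed
  then show ?thesis
    by (simp add: continuous_at_imp_continuous_on)
qed

text \<open>Parseval's identity. The sections are expanded pointwise under the integral, first in
  the left and then in the right argument, until only the integrals of pairs of basis sections
  remain.\<close>

lemma section_inner_combination:
  fixes A :: "('m::t2_space, 'n::finite) atlas" and s :: "'k::finite \<Rightarrow> 'm \<Rightarrow> 'l"
  assumes comp: "compact (UNIV :: 'm set)" and A: "complex_atlas A" and \<omega>: "is_form11 A \<omega>"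
    and L: "holomorphic_line_bundle A L" and h: "hermitian_metric A L h"
    and s: "orthonormal_section_basis A \<omega> L h s"
    and \<phi>: "\<phi> \<in> hol_sections A L" "section_combination L a s \<phi>"
    and \<psi>: "\<psi> \<in> hol_sections A L" "section_combination L b s \<psi>"
  shows "section_inner A \<omega> h \<phi> \<psi> = (\<Sum>j\<in>UNIV. cnj (a j) * b j)"
proof -
  have sh: "s j \<in> hol_sections A L" for j
    using s unfolding orthonormal_section_basis_def section_basis_def by blast
  note pr = hol_sections_proj[OF sh] hol_sections_proj[OF \<phi>(1)] hol_sections_proj[OF \<psi>(1)]
  have on: "section_inner A \<omega> h (s j) (s k) = (if j = k then 1 else 0)" for j k
    using s unfolding orthonormal_section_basis_def by blast
  note cont = continuous_on_metric_of_sections[OF A L h]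
  have l: "h (\<phi> x) r = (\<Sum>j\<in>UNIV. cnj (a j) * h (s j x) r)" if r: "lb_proj L r = x" for x r
  proof -
    obtain U \<tau> where U: "(U, \<tau>) \<in> lb_trivs L" "x \<in> U"
      using trivialisation_exists[OF L] by blast
    have "\<tau> (\<phi> x) = (\<Sum>j\<in>UNIV. a j * \<tau> (s j x))"
      using \<phi>(2) U unfolding section_combination_iff[OF L pr(2,1)] by blast
    then show ?thesis
      by (simp add: hermitian_metric_eq[OF L U h] pr r sum_distrib_left sum_distrib_right mult_ac)
  qed
  have rr: "h r (\<psi> x) = (\<Sum>j\<in>UNIV. b j * h r (s j x))" if r: "lb_proj L r = x" for x r
  proof -
    obtain U \<tau> where U: "(U, \<tau>) \<in> lb_trivs L" "x \<in> U"
      using trivialisation_exists[OF L] by blast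
    have "\<tau> (\<psi> x) = (\<Sum>j\<in>UNIV. b j * \<tau> (s j x))"
      using \<psi>(2) U unfolding section_combination_iff[OF L pr(3,1)] by blast
    then show ?thesis
      by (simp add: hermitian_metric_eq[OF L U h] pr r sum_distrib_right sum_distrib_left mult_ac)
  qed
  have "section_inner A \<omega> h \<phi> \<psi> = (\<Sum>j\<in>UNIV. cnj (a j) * section_inner A \<omega> h (s j) \<psi>)"
    unfolding section_inner_def l[OF pr(3)]
    by (intro volume_integral_linear_combination comp A \<omega> cont sh \<psi>)
  also have "\<dots> = (\<Sum>j\<in>UNIV. cnj (a j) * (\<Sum>k\<in>UNIV. b k * section_inner A \<omega> h (s j) (s k)))"
    unfolding section_inner_def rr[OF pr(1)]
    by (intro sum.cong refl arg_cong2[where f = "(*)"] volume_integral_linear_combination comp A \<omega> cont sh)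
  also have "\<dots> = (\<Sum>j\<in>UNIV. cnj (a j) * b j)"
    by (simp add: on if_distrib cong: if_cong)
  finally show ?thesis .
qed

text \<open>Riesz representation in an orthonormal basis. The coefficients are conjugated because
  \<open>section_inner\<close> is conjugate linear in its first argument. Any other solution has the
  same coefficients, as pairing it with \<open>s k\<close> shows.\<close>

lemma coherent_vector_combination:
  fixes A :: "('m::t2_space, 'n::finite) atlas" and s :: "'k::finite \<Rightarrow> 'm \<Rightarrow> 'l"
  assumes comp: "compact (UNIV :: 'm set)" and A: "complex_atlas A" and \<omega>: "is_form11 A \<omega>"
    and L: "holomorphic_line_bundle A L" and h: "hermitian_metric A L h"
    and s: "orthonormal_section_basis A \<omega> L h s" and q: "q \<in> nonzero_vectors L"
  shows "coherent_vector A \<omega> L h q \<in> hol_sections A L"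
    and "section_combination L (\<lambda>j. cnj (qhat L q (s j))) s (coherent_vector A \<omega> L h q)"
proof -
  let ?a = "\<lambda>j. cnj (qhat L q (s j))"
  have sh: "s j \<in> hol_sections A L" for j
    using s unfolding orthonormal_section_basis_def section_basis_def by blast
  have ex: "\<exists>b. section_combination L b s \<phi>" if "\<phi> \<in> hol_sections A L" for \<phi>
  proof -
    have "\<forall>\<phi>\<in>hol_sections A L. \<exists>!a. section_combination L a s \<phi>"
      using s unfolding orthonormal_section_basis_def section_basis_def by (elim conjE)
    from bspec[OF this that] show ?thesis by (rule ex1_implies_ex)
  qed
  note inner = section_inner_combination[OF comp A \<omega> L h s]
  obtain e where e: "e \<in> hol_sections A L" "section_combination L ?a s e"
    by (rule section_combination_exists[OF A L sh])
  have "coherent_vector A \<omega> L h q = e"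
    unfolding coherent_vector_def
  proof (rule the_equality, intro conjI ballI)
    show "e \<in> hol_sections A L" by fact
  next
    fix \<psi> assume \<psi>: "\<psi> \<in> hol_sections A L"
    then obtain b where b: "section_combination L b s \<psi>" using ex by blast
    then have "qhat L q \<psi> = (\<Sum>j\<in>UNIV. b j * qhat L q (s j))"
      using q unfolding section_combination_def by blast
    then show "section_inner A \<omega> h e \<psi> = qhat L q \<psi>"
      by (simp add: inner[OF e \<psi> b] mult.commute)
  next
    fix e' assume e': "e' \<in> hol_sections A L \<and> (\<forall>\<psi>\<in>hol_sections A L. section_inner A \<omega> h e' \<psi> = qhat L q \<psi>)"
    then obtain a where a: "section_combination L a s e'" using ex by blast
    have "cnj (a k) = qhat L q (s k)" for k
    proof -
      have "section_combination L (\<lambda>j. if j = k then 1 else 0) s (s k)"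
        unfolding section_combination_def by (simp add: if_distrib[of "\<lambda>x. x * _"] cong: if_cong)
      then have "section_inner A \<omega> h e' (s k) = (\<Sum>j\<in>UNIV. cnj (a j) * (if j = k then 1 else 0))"
        using inner[OF conjunct1[OF e'] a sh] by blast
      then show ?thesis using e' sh by (simp add: if_distrib cong: if_cong)
    qed
    from this[symmetric] have "a = ?a" by auto
    then show "e' = e"
      using e' a by (intro section_combination_unique[OF L _ _ _ _ e(2)])
        (auto intro: hol_sections_proj sh e(1))
  qed
  then show "coherent_vector A \<omega> L h q \<in> hol_sections A L"
    and "section_combination L ?a s (coherent_vector A \<omega> L h q)"
    using e by auto
qed

text \<open>The coefficients of a coherent vector are conjugated homogeneous coordinates, so
  \<open>q\<close> and \<open>q'\<close> change places. This reversal decides the orientation in the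
  final formula.\<close>

lemma section_inner_coherent_vectors:
  fixes A :: "('m::t2_space, 'n::finite) atlas" and s :: "'k::finite \<Rightarrow> 'm \<Rightarrow> 'l"
  assumes "compact (UNIV :: 'm set)" "complex_atlas A" "is_form11 A \<omega>"
    "holomorphic_line_bundle A L" "hermitian_metric A L h" "orthonormal_section_basis A \<omega> L h s"
    and "q \<in> nonzero_vectors L" "q' \<in> nonzero_vectors L"
  shows "section_inner A \<omega> h (coherent_vector A \<omega> L h q) (coherent_vector A \<omega> L h q') =
    cinner (\<chi> j. qhat L q' (s j)) (\<chi> j. qhat L q (s j))"
  unfolding section_inner_combination[OF assms(1-6) coherent_vector_combination[OF assms(1-7)]
      coherent_vector_combination[OF assms(1-6,8)]]
  by (simp add: cinner_def mult.commute)

text \<open>The vector picked by \<open>SOME\<close> in \<open>projective_map\<close> differs from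
  \<open>q\<close> by a scalar of the same fibre, which rescales all coordinates at once.\<close>

lemma projective_map_eq:
  assumes L: "holomorphic_line_bundle A L" and b: "\<And>j x. lb_proj L (b j x) = x"
    and q: "q \<in> nonzero_vectors L"
  shows "projective_map L b (lb_proj L q) = proj_point (\<chi> j. qhat L q (b j))"
proof -
  define q0 where "q0 = (SOME q'. q' \<in> nonzero_vectors L \<and> lb_proj L q' = lb_proj L q)"
  have q0: "q0 \<in> nonzero_vectors L" "lb_proj L q0 = lb_proj L q"
    using someI[of "\<lambda>q'. q' \<in> nonzero_vectors L \<and> lb_proj L q' = lb_proj L q" q] q
    unfolding q0_def by auto
  obtain U \<tau> where U: "(U, \<tau>) \<in> lb_trivs L" "lb_proj L q \<in> U"
    using trivialisation_exists[OF L] by blast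
  have nz: "\<tau> q \<noteq> 0" "\<tau> q0 \<noteq> 0"
    using nonzero_vectors_iff[OF L U(1)] q q0 U(2) by auto
  define u where "u = (\<chi> j. qhat L q (b j))"
  define c where "c = \<tau> q / \<tau> q0"
  have c: "c \<noteq> 0" using nz by (simp add: c_def)
  have "(\<chi> j. qhat L q0 (b j)) = c *s u"
    using nz U q0 q
    by (simp add: vec_eq_iff c_def u_def qhat_eq[OF L U(1) _ _ b])
  moreover have "range (\<lambda>a. a *s (c *s u)) = range (\<lambda>a. a *s u)"
  proof -
    have "a *s u = (a / c) *s (c *s u)" for a using c by (simp add: vector_smult_assoc)
    then have "range (\<lambda>a. a *s u) \<subseteq> range (\<lambda>a. a *s (c *s u))" by blast
    moreover have "range (\<lambda>a. a *s (c *s u)) \<subseteq> range (\<lambda>a. a *s u)"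
      by (auto simp: vector_smult_assoc)
    ultimately show ?thesis by blast
  qed
  ultimately show ?thesis
    unfolding projective_map_def q0_def[symmetric] u_def[symmetric] Let_def
    by (simp add: proj_point_def)
qed

section \<open>Phases of scalar products of points\<close>

lemma cinner_scale: "cinner (a *s u) (b *s v) = cnj a * b * cinner u v"
  by (simp add: cinner_def sum_distrib_left mult_ac)

lemma cinner_commute: "cinner v u = cnj (cinner u v)"
  by (simp add: cinner_def mult.commute)

lemma cnj_mult_self: "cnj z * z = of_real ((cmod z)\<^sup>2)"
  by (metis complex_norm_square mult.commute)

lemma sgn_cnj_mult_self:
  assumes "z \<noteq> 0"
  shows "sgn (cnj z * z) = 1"
  using assms unfolding cnj_mult_self sgn_of_real by simp

lemma cinner_self: "cinner u u = of_real ((norm u)\<^sup>2)"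
  by (simp add: cinner_def norm_vec_def L2_set_def sum_nonneg cnj_mult_self del: of_real_power)

lemma cinner_add_left: "cinner (u + v) w = cinner u w + cinner v w"
  and cinner_add_right: "cinner w (u + v) = cinner w u + cinner w v"
  and cinner_diff_left: "cinner (u - v) w = cinner u w - cinner v w"
  and cinner_diff_right: "cinner w (u - v) = cinner w u - cinner w v"
  by (simp_all add: cinner_def algebra_simps sum.distrib sum_subtractf)

lemma cinner_Cauchy_Schwarz: "cmod (cinner u v) \<le> norm u * norm v"
proof -
  have "cmod (cinner u v) \<le> (\<Sum>j\<in>UNIV. \<bar>cmod (u $ j)\<bar> * \<bar>cmod (v $ j)\<bar>)"
    unfolding cinner_def by (rule order_trans[OF norm_sum]) (simp add: norm_mult)
  also have "\<dots> \<le> norm u * norm v"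
    unfolding norm_vec_def by (rule L2_set_mult_ineq)
  finally show ?thesis .
qed

lemma norm_vector_scalar_mult: "norm (a *s u) = cmod a * norm (u :: complex^'k::finite)"
  by (simp add: norm_vec_def norm_mult L2_set_right_distrib)

lemma vec_smult_eq: "(r *\<^sub>R u :: complex^'k::finite) = of_real r *s u"
  by (simp add: vec_eq_iff scaleR_conv_of_real[where 'a = complex])

lemma proj_space_nonzero_member:
  assumes "p \<in> proj_space" "u \<in> p" "u \<noteq> 0"
  shows "p = proj_point u"
proof -
  obtain v where v: "p = proj_point v"
    using assms(1) unfolding proj_space_def by blast
  then obtain a where a: "u = a *s v"
    using assms(2) unfolding proj_point_def by blast
  with assms(3) have "a \<noteq> 0" by auto
  then have "b *s v = (b / a) *s u" for b
    by (simp add: a)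
  then have "proj_point v \<subseteq> proj_point u"
    unfolding proj_point_def by blast
  moreover have "proj_point u \<subseteq> proj_point v"
    unfolding proj_point_def a by auto
  ultimately show ?thesis using v by blast
qed

lemma nonzero_if_proj_point_in_proj_space:
  assumes "proj_point u \<in> proj_space"
  shows "u \<noteq> 0"
proof
  assume "u = 0"
  then have "proj_point u = {0}" by (auto simp: proj_point_def)
  moreover obtain v where "proj_point u = proj_point v" "v \<noteq> 0"
    using assms unfolding proj_space_def by blast
  moreover have "1 *s v \<in> proj_point v"
    unfolding proj_point_def by (rule rangeI)
  ultimately show False by simp
qed

lemma in_proj_point: "u \<in> proj_point u"
  unfolding proj_point_def by (rule range_eqI[of _ _ 1]) simp

lemma representativeD:
  assumes "p \<in> proj_space"
  shows "representative p \<in> p" "representative p \<noteq> 0"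
proof -
  obtain v where "p = proj_point v" "v \<noteq> 0"
    using assms unfolding proj_space_def by blast
  then have "\<exists>u. u \<in> p \<and> u \<noteq> 0" using in_proj_point by blast
  from someI_ex[OF this] show "representative p \<in> p" "representative p \<noteq> 0"
    unfolding representative_def by auto
qed

lemma representative_multiple:
  assumes "p \<in> proj_space" "u \<in> p" "u \<noteq> 0"
  obtains a where "a \<noteq> 0" "representative p = a *s u"
proof -
  have "representative p \<in> proj_point u"
    using representativeD(1)[OF assms(1)] proj_space_nonzero_member[OF assms] by simp
  then obtain a where "representative p = a *s u"
    unfolding proj_point_def by blast
  moreover from this have "a \<noteq> 0"
    using representativeD(2)[OF assms(1)] by auto
  ultimately show thesis using that by blast
qed

lemma cos_cayley_dist:
  assumes p: "p \<in> proj_space" "u \<in> p" "u \<noteq> 0" and r: "r \<in> proj_space" "v \<in> r" "v \<noteq> 0"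
  shows "cos (cayley_dist p r) = cmod (cinner u v) / (norm u * norm v)" "0 \<le> cayley_dist p r"
proof -
  obtain a where a: "a \<noteq> 0" "representative p = a *s u" by (rule representative_multiple[OF p])
  obtain b where b: "b \<noteq> 0" "representative r = b *s v" by (rule representative_multiple[OF r])
  have "cayley_dist p r = arccos (cmod (cinner u v) / (norm u * norm v))"
    using a b by (simp add: cayley_dist_def Let_def cinner_scale norm_mult norm_vector_scalar_mult)
  moreover have "- 1 \<le> cmod (cinner u v) / (norm u * norm v)"
    by (rule order_trans[of _ 0]) simp_all
  moreover have "cmod (cinner u v) / (norm u * norm v) \<le> 1"
    using cinner_Cauchy_Schwarz[of u v] p r by (simp add: divide_le_eq)
  ultimately show "cos (cayley_dist p r) = cmod (cinner u v) / (norm u * norm v)"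
    "0 \<le> cayley_dist p r"
    by (simp_all add: cos_arccos arccos_lbound)
qed

text \<open>The value depends on the representatives chosen by \<open>SOME\<close> and is 0 for
  orthogonal lines. Only the product around a closed polygon is intrinsic: it is the phase of the
  Bargmann invariant of the vertices.\<close>

definition link_phase :: "'k::finite point \<Rightarrow> 'k point \<Rightarrow> complex" where
  "link_phase p r = sgn (cinner (representative p) (representative r))"

text \<open>Orthogonal lines are no exception, as both sides are then 0.\<close>

lemma link_phase_inverse: "link_phase r p = inverse (link_phase p r)"
proof -
  have "sgn (cnj z) = inverse (sgn z)" for z :: complex
  proof (cases "z = 0")
    case False
    then have "sgn z * sgn (cnj z) = 1"
      using sgn_cnj_mult_self[OF False] by (simp add: sgn_mult mult.commute)
    then show ?thesis by (metis inverse_unique)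
  qed simp
  then show ?thesis
    unfolding link_phase_def by (subst cinner_commute) simp
qed

lemma link_phase_self:
  assumes "p \<in> proj_space"
  shows "link_phase p p = 1"
  using representativeD(2)[OF assms] unfolding link_phase_def cinner_self sgn_of_real by simp

lemma norm_link_phase_le: "norm (link_phase p r) \<le> 1"
  by (simp add: link_phase_def norm_sgn)

text \<open>In a cycle every vector stands once on the left and once on the right, so a scalar
  \<open>a\<close> enters as the positive number \<open>cnj a * a\<close>, which \<open>sgn\<close>
  ignores.\<close>

lemma sgn_scaled_cinner_cycle3:
  fixes a b c d :: complex
  assumes "a \<noteq> 0" "b \<noteq> 0" "c \<noteq> 0"
  shows "sgn (cinner (a *s u) (b *s v) * cinner (b *s v) (c *s w) * cinner (c *s w) (a *s u)) =
    sgn (cinner u v * cinner v w * cinner w u)"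
proof -
  have "cinner (a *s u) (b *s v) * cinner (b *s v) (c *s w) * cinner (c *s w) (a *s u) =
    (cnj a * a) * (cnj b * b) * (cnj c * c) * (cinner u v * cinner v w * cinner w u)"
    by (simp add: cinner_scale mult_ac)
  then show ?thesis
    using assms[THEN sgn_cnj_mult_self] by (simp only: sgn_mult[of "_ * cinner _ _"] mult_1_left sgn_mult)
qed

lemma sgn_scaled_cinner_cycle4:
  assumes "a \<noteq> 0" "b \<noteq> 0" "c \<noteq> 0" "d \<noteq> 0"
  shows "sgn (cinner (a *s u) (b *s v) * cinner (b *s v) (c *s w) * cinner (c *s w) (d *s x) *
      cinner (d *s x) (a *s u)) =
    sgn (cinner u v * cinner v w * cinner w x * cinner x u)"
proof -
  have "cinner (a *s u) (b *s v) * cinner (b *s v) (c *s w) * cinner (c *s w) (d *s x) *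
      cinner (d *s x) (a *s u) =
    (cnj a * a) * (cnj b * b) * (cnj c * c) * (cnj d * d) *
      (cinner u v * cinner v w * cinner w x * cinner x u)"
    by (simp add: cinner_scale mult_ac)
  then show ?thesis
    using assms[THEN sgn_cnj_mult_self] by (simp only: sgn_mult[of "_ * cinner _ _"] mult_1_left sgn_mult)
qed

lemma link_phase_cycle3:
  assumes p: "p \<in> proj_space" "u \<in> p" "u \<noteq> 0" and q: "q \<in> proj_space" "v \<in> q" "v \<noteq> 0"
    and r: "r \<in> proj_space" "w \<in> r" "w \<noteq> 0"
  shows "link_phase p q * link_phase q r * link_phase r p = sgn (cinner u v * cinner v w * cinner w u)"
proof -
  obtain a where a: "a \<noteq> 0" "representative p = a *s u" by (rule representative_multiple[OF p])
  obtain b where b: "b \<noteq> 0" "representative q = b *s v" by (rule representative_multiple[OF q])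
  obtain c where c: "c \<noteq> 0" "representative r = c *s w" by (rule representative_multiple[OF r])
  show ?thesis
    using sgn_scaled_cinner_cycle3[OF a(1) b(1) c(1), of u v w]
    by (simp only: link_phase_def a(2) b(2) c(2) sgn_mult)
qed

lemma link_phase_cycle4:
  assumes p: "p \<in> proj_space" "u \<in> p" "u \<noteq> 0" and q: "q \<in> proj_space" "v \<in> q" "v \<noteq> 0"
    and r: "r \<in> proj_space" "w \<in> r" "w \<noteq> 0" and t: "t \<in> proj_space" "x \<in> t" "x \<noteq> 0"
  shows "link_phase p q * link_phase q r * link_phase r t * link_phase t p =
    sgn (cinner u v * cinner v w * cinner w x * cinner x u)"
proof -
  obtain a where a: "a \<noteq> 0" "representative p = a *s u" by (rule representative_multiple[OF p])
  obtain b where b: "b \<noteq> 0" "representative q = b *s v" by (rule representative_multiple[OF q])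
  obtain c where c: "c \<noteq> 0" "representative r = c *s w" by (rule representative_multiple[OF r])
  obtain d where d: "d \<noteq> 0" "representative t = d *s x" by (rule representative_multiple[OF t])
  show ?thesis
    using sgn_scaled_cinner_cycle4[OF a(1) b(1) c(1) d(1), of u v w x]
    by (simp only: link_phase_def a(2) b(2) c(2) d(2) sgn_mult)
qed

text \<open>The equality case of the triangle inequality: the component of \<open>u\<close> orthogonal to \<open>v\<close>
  pairs with that of \<open>w\<close> to at most \<open>sin \<alpha> sin \<beta>\<close>, and this forces \<open>\<langle>u,w\<rangle>\<close> and
  \<open>\<langle>u,v\<rangle>\<langle>v,w\<rangle>\<close> to point in the same direction.\<close>

lemma sgn_cinner_collinear:
  fixes u v w :: "complex^'k::finite"
  assumes "norm u = 1" "norm v = 1" "norm w = 1"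
    and uv: "cmod (cinner u v) = cos \<alpha>" and vw: "cmod (cinner v w) = cos \<beta>"
    and uw: "cmod (cinner u w) = cos (\<alpha> + \<beta>)" and ab: "0 \<le> \<alpha>" "0 \<le> \<beta>" "\<alpha> + \<beta> < pi / 2"
  shows "sgn (cinner u w) = sgn (cinner u v) * sgn (cinner v w)"
proof -
  define u' where "u' = u - cinner v u *s v"
  define w' where "w' = w - cinner v w *s v"
  have one: "cinner u u = 1" "cinner v v = 1" "cinner w w = 1"
    using assms(1-3) by (simp_all add: cinner_self)
  have sc: "cinner (a *s x) y = cnj a * cinner x y" "cinner x (a *s y) = a * cinner x y" for a x y
    using cinner_scale[of a x 1 y] cinner_scale[of 1 x a y] by simp_all
  have sq: "z * cnj z = of_real ((cmod z)\<^sup>2)" for z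
    by (simp only: complex_norm_square)
  have "cinner u' u' = 1 - cinner u v * cnj (cinner u v)"
    by (simp add: u'_def cinner_diff_left cinner_diff_right sc one cinner_commute[of v u] mult.commute)
  also have "\<dots> = of_real ((sin \<alpha>)\<^sup>2)"
    unfolding sq uv sin_squared_eq by simp
  finally have "(norm u')\<^sup>2 = (sin \<alpha>)\<^sup>2"
    unfolding cinner_self of_real_eq_iff .
  then have nu: "norm u' = sin \<alpha>"
    using ab sin_ge_zero[of \<alpha>] by (simp add: power2_eq_iff_nonneg)
  have "cinner w' w' = 1 - cinner v w * cnj (cinner v w)"
    by (simp add: w'_def cinner_diff_left cinner_diff_right sc one cinner_commute[of w v] mult.commute)
  also have "\<dots> = of_real ((sin \<beta>)\<^sup>2)"
    unfolding sq vw sin_squared_eq by simp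
  finally have "(norm w')\<^sup>2 = (sin \<beta>)\<^sup>2"
    unfolding cinner_self of_real_eq_iff .
  then have nw: "norm w' = sin \<beta>"
    using ab sin_ge_zero[of \<beta>] by (simp add: power2_eq_iff_nonneg)
  let ?X = "cinner u w" and ?Y = "cinner u v * cinner v w"
  have "cinner u' w' = ?X - ?Y"
    by (simp add: u'_def w'_def cinner_diff_left cinner_diff_right sc one cinner_commute[of v u] mult.commute)
  then have d: "cmod (?Y - ?X) \<le> sin \<alpha> * sin \<beta>"
    using cinner_Cauchy_Schwarz[of u' w'] nu nw by (simp add: norm_minus_commute)
  \<comment> \<open>By the addition theorem for the cosine, \<open>cmod ?Y\<close> is the upper
    bound that \<open>d\<close> gives for \<open>cmod ?X + cmod (?Y - ?X)\<close>; this forces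
    equality in the triangle inequality.\<close>
  have Y: "cmod ?Y = cmod ?X + sin \<alpha> * sin \<beta>"
    unfolding norm_mult uv vw uw by (simp add: cos_add)
  have "cmod (?X + (?Y - ?X)) = cmod ?X + cmod (?Y - ?X)"
    using d Y norm_triangle_ineq[of ?X "?Y - ?X"] by simp
  then have col: "cmod ?X *\<^sub>R (?Y - ?X) = cmod (?Y - ?X) *\<^sub>R ?X"
    by (simp only: norm_triangle_eq)
  \<comment> \<open>Here \<open>\<alpha> + \<beta> < pi / 2\<close> enters: if \<open>?X\<close>
    were 0, the equation \<open>col\<close> would say nothing about \<open>?Y\<close>.\<close>
  have X0: "cmod ?X > 0"
    unfolding uw using ab by (intro cos_gt_zero_pi) auto
  have "cmod ?X *\<^sub>R ?Y = (cmod ?X + cmod (?Y - ?X)) *\<^sub>R ?X"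
    using col by (simp add: algebra_simps)
  then have "sgn (cmod ?X *\<^sub>R ?Y) = sgn ((cmod ?X + cmod (?Y - ?X)) *\<^sub>R ?X)"
    by simp
  moreover have "cmod ?X + cmod (?Y - ?X) > 0"
    using X0 norm_ge_zero[of "?Y - ?X"] by linarith
  ultimately show ?thesis
    using X0 by (simp add: sgn_scaleR sgn_mult)
qed

lemma link_phase_collinear:
  assumes p: "p \<in> proj_space" and q: "q \<in> proj_space" and r: "r \<in> proj_space"
    and sum: "cayley_dist p r = cayley_dist p q + cayley_dist q r" and lt: "cayley_dist p r < pi / 2"
  shows "link_phase p r = link_phase p q * link_phase q r"
proof -
  note R = representativeD
  let ?n = "\<lambda>p. of_real (inverse (norm (representative p))) *s representative p"
  have cos: "cmod (cinner (?n p) (?n q)) = cos (cayley_dist p q)" "0 \<le> cayley_dist p q"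
    if "p \<in> proj_space" "q \<in> proj_space" for p q :: "'a point"
    using cos_cayley_dist[OF that(1) R[OF that(1)] that(2) R[OF that(2)]]
    by (simp_all add: cinner_scale norm_mult norm_inverse norm_divide field_simps)
  have sgn: "sgn (cinner (?n p) (?n q)) = link_phase p q"
    if "p \<in> proj_space" "q \<in> proj_space" for p q :: "'a point"
  proof -
    have "cinner (?n p) (?n q) = (inverse (norm (representative p)) * inverse (norm (representative q))) *\<^sub>R
        cinner (representative p) (representative q)"
      by (simp add: cinner_scale scaleR_conv_of_real)
    then show ?thesis
      using R(2)[OF that(1)] R(2)[OF that(2)] unfolding link_phase_def by (simp only: sgn_scaleR) simp
  qed
  have n: "norm (?n p) = 1" if "p \<in> proj_space" for p :: "'a point"
    using R(2)[OF that] by (simp add: norm_vector_scalar_mult norm_inverse)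
  show ?thesis
    using sgn_cinner_collinear[OF n[OF p] n[OF q] n[OF r] cos(1)[OF p q] cos(1)[OF q r] _
        cos(2)[OF p q] cos(2)[OF q r]] cos(1)[OF p r] sum lt
    unfolding sgn[OF p q] sgn[OF q r] sgn[OF p r] by simp
qed

section \<open>Phases along geodesics and around a grid\<close>

lemma geodesic_endpoints:
  assumes "geodesic p r \<gamma>"
  shows "p \<in> proj_space" "r \<in> proj_space"
proof -
  have "\<gamma> 0 = p" "\<gamma> 1 = r" "\<forall>t\<in>{0..1}. \<gamma> t \<in> proj_space"
    using assms unfolding geodesic_def by simp_all
  then show "p \<in> proj_space" "r \<in> proj_space" by auto
qed

text \<open>Distances add up along a geodesic, so \<open>link_phase_collinear\<close> applies to its
  start and two consecutive grid points. For \<open>n = N\<close> the product does not depend on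
  \<open>N\<close>, which keeps the boundary phase fixed while the grid is refined.\<close>

lemma geodesic_link_phase_prod:
  assumes \<gamma>: "geodesic p r \<gamma>" and lt: "cayley_dist p r < pi / 2" and n: "n \<le> N" "N > 0"
  shows "(\<Prod>i<n. link_phase (\<gamma> (real i / real N)) (\<gamma> (real (Suc i) / real N))) =
    link_phase p (\<gamma> (real n / real N))"
  using n(1)
proof (induction n)
  have \<gamma>0: "\<gamma> 0 = p"
    using \<gamma> unfolding geodesic_def by auto
  have \<gamma>P: "\<gamma> t \<in> proj_space" if "t \<in> {0..1}" for t
    using \<gamma> that unfolding geodesic_def by auto
  have \<gamma>d: "cayley_dist (\<gamma> t') (\<gamma> t) = \<bar>t' - t\<bar> * cayley_dist p r"
    if "t' \<in> {0..1}" "t \<in> {0..1}" for t t'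
    using \<gamma> that unfolding geodesic_def by auto
  {
    case 0
    show ?case
      using \<gamma>0 \<gamma>P[of 0] link_phase_self[of p] by simp
  next
    case (Suc n)
    let ?t = "real n / real N" and ?t' = "real (Suc n) / real N"
    have t: "?t \<in> {0..1}" "?t' \<in> {0..1}" "0 \<le> ?t" "?t \<le> ?t'" "(0::real) \<in> {0..1}"
      using Suc.prems n(2) by (auto simp: divide_simps)
    have d: "cayley_dist p (\<gamma> ?t) = ?t * cayley_dist p r"
      "cayley_dist p (\<gamma> ?t') = ?t' * cayley_dist p r"
      "cayley_dist (\<gamma> ?t) (\<gamma> ?t') = (?t' - ?t) * cayley_dist p r"
      using \<gamma>d[OF t(5,1)] \<gamma>d[OF t(5,2)] \<gamma>d[OF t(1,2)] t(3,4) by (simp_all add: \<gamma>0)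
    \<comment> \<open>The distance is a fraction of the whole one if the latter is nonnegative;
      otherwise the bound is trivial.\<close>
    have "cayley_dist p (\<gamma> ?t') < pi / 2"
    proof (cases "cayley_dist p r \<ge> 0")
      case True
      then have "?t' * cayley_dist p r \<le> 1 * cayley_dist p r"
        using t(2) by (intro mult_right_mono) auto
      then show ?thesis unfolding d(2) by (rule le_less_trans) (use lt in simp)
    next
      case False
      then have "?t' * cayley_dist p r \<le> 0"
        using t(2) by (intro mult_nonneg_nonpos) auto
      then show ?thesis unfolding d(2) by (rule le_less_trans) simp
    qed
    moreover have "cayley_dist p (\<gamma> ?t') = cayley_dist p (\<gamma> ?t) + cayley_dist (\<gamma> ?t) (\<gamma> ?t')"
      unfolding d by (simp add: algebra_simps)
    ultimately have "link_phase p (\<gamma> ?t') = link_phase p (\<gamma> ?t) * link_phase (\<gamma> ?t) (\<gamma> ?t')"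
      using link_phase_collinear[OF \<gamma>P[OF t(5)] \<gamma>P[OF t(1)] \<gamma>P[OF t(2)]] by (simp only: \<gamma>0)
    then show ?case using Suc by simp
  }
qed

text \<open>An inner edge belongs to two cells, which run through it in opposite directions. Its two
  factors cancel only if they are nonzero, since \<open>inverse 0 = 0\<close>.\<close>

lemma prod_grid_telescope:
  fixes h v :: "nat \<Rightarrow> nat \<Rightarrow> 'a::field"
  assumes h: "\<And>i j. i < N \<Longrightarrow> j \<le> N \<Longrightarrow> h i j \<noteq> 0" and v: "\<And>i j. i \<le> N \<Longrightarrow> j < N \<Longrightarrow> v i j \<noteq> 0"
  shows "(\<Prod>i<N. \<Prod>j<N. h i j * v (Suc i) j * inverse (h i (Suc j)) * inverse (v i j)) =
    (\<Prod>i<N. h i 0) * (\<Prod>j<N. v N j) * inverse (\<Prod>i<N. h i N) * inverse (\<Prod>j<N. v 0 j)"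
proof -
  have "(\<Prod>j<N. h i j / h i (Suc j)) = h i 0 / h i N" if "i < N" for i
    by (rule prod_lessThan_telescope') (use h that in auto)
  moreover have "(\<Prod>i<N. v (Suc i) j / v i j) = v N j / v 0 j" if "j < N" for j
    by (rule prod_lessThan_telescope[where f = "\<lambda>i. v i j"]) (use v that in auto)
  moreover have "(\<Prod>i<N. \<Prod>j<N. h i j * v (Suc i) j * inverse (h i (Suc j)) * inverse (v i j)) =
      (\<Prod>i<N. \<Prod>j<N. h i j / h i (Suc j)) * (\<Prod>j<N. \<Prod>i<N. v (Suc i) j / v i j)"
    by (subst (2) prod.swap) (simp add: prod.distrib[symmetric] field_simps)
  ultimately have "(\<Prod>i<N. \<Prod>j<N. h i j * v (Suc i) j * inverse (h i (Suc j)) * inverse (v i j)) =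
      (\<Prod>i<N. h i 0 / h i N) * (\<Prod>j<N. v N j / v 0 j)"
    by simp
  then show ?thesis
    unfolding prod_dividef by (simp add: divide_inverse mult_ac)
qed

section \<open>The Fubini-Study metric as a limit of phases\<close>

text \<open>The Fubini-Study hermitian metric in homogeneous coordinates; its kernel contains \<open>w\<close>, so that
  it is well defined on tangent vectors of the projective space.\<close>

definition fs_herm :: "complex^'k::finite \<Rightarrow> complex^'k \<Rightarrow> complex^'k \<Rightarrow> complex" where
  "fs_herm w x y = (cinner x y * cinner w w - cinner x w * cinner w y) / (cinner w w)\<^sup>2"

lemma cinner_self_eq_0_iff [simp]: "cinner w w = 0 \<longleftrightarrow> w = 0"
  by (simp add: cinner_self)

lemma fs_herm_commute: "fs_herm w y x = cnj (fs_herm w x y)"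
  by (simp add: fs_herm_def cinner_commute[of y x] cinner_commute[of y w] cinner_commute[of w x]
      cinner_self mult.commute)

lemma fs_herm_add_left: "fs_herm w (x + x') y = fs_herm w x y + fs_herm w x' y"
  and fs_herm_add_right: "fs_herm w x (y + y') = fs_herm w x y + fs_herm w x y'"
  by (simp_all add: fs_herm_def cinner_add_left cinner_add_right algebra_simps add_divide_distrib
      diff_divide_distrib)

lemma Im_fs_herm_self: "Im (fs_herm w x x) = 0"
  using fs_herm_commute[of w x x] by (simp add: complex_eq_iff)

text \<open>Tangent vectors arrive in this shape after a change of affine coordinates with factor
  \<open>f\<close>. The multiples of \<open>w\<close> lie in the kernel, and \<open>f\<close> enters
  numerator and denominator through the same power of \<open>f * cnj f\<close>.\<close>

lemma fs_herm_rescale: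
  assumes "f \<noteq> 0" "w \<noteq> 0"
  shows "fs_herm (f *s w) (a *s w + f *s x) (b *s w + f *s y) = fs_herm w x y"
proof -
  have n: "cinner w w \<noteq> 0" "f * cnj f \<noteq> 0"
    using assms by auto
  have "cinner (a *s w + f *s x) (b *s w + f *s y) * cinner (f *s w) (f *s w) -
      cinner (a *s w + f *s x) (f *s w) * cinner (f *s w) (b *s w + f *s y) =
      (f * cnj f)\<^sup>2 * (cinner x y * cinner w w - cinner x w * cinner w y)"
    by (simp add: cinner_add_left cinner_add_right cinner_scale algebra_simps power2_eq_square)
  moreover have "(cinner (f *s w) (f *s w))\<^sup>2 = (f * cnj f)\<^sup>2 * (cinner w w)\<^sup>2"
    by (simp add: cinner_scale power_mult_distrib mult_ac)
  ultimately show ?thesis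
    using n by (simp add: fs_herm_def)
qed

text \<open>As \<open>w $ k = 1\<close>, the number \<open>S\<close> of the affine formula is the
  squared norm of \<open>w\<close>; as \<open>u\<close> and \<open>v\<close> vanish at
  \<open>k\<close>, the zero row and column may be replaced by the general expression. The order
  \<open>v\<close>, \<open>u\<close> is due to conjugate linearity of \<open>fs_herm w\<close> in
  its first argument.\<close>

lemma fubini_study_bilinear:
  assumes w: "w $ k = 1" and u: "u $ k = 0" and v: "v $ k = 0"
  shows "(\<Sum>j\<in>UNIV. \<Sum>l\<in>UNIV. fubini_study k w $ j $ l * (u $ j * cnj (v $ l))) = fs_herm w v u"
proof -
  define S where "S = 1 + (\<Sum>j\<in>- {k}. (cmod (w $ j))\<^sup>2)"
  have "(\<Sum>j\<in>UNIV. (cmod (w $ j))\<^sup>2) = S"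
    unfolding S_def using w by (simp add: sum.remove[of UNIV k] Compl_eq_Diff_UNIV)
  then have "(norm w)\<^sup>2 = S"
    unfolding norm_vec_def L2_set_def by (subst real_sqrt_pow2) (auto intro: sum_nonneg)
  then have S: "cinner w w = of_real S"
    by (simp only: cinner_self)
  have "fubini_study k w $ j $ l * (u $ j * cnj (v $ l)) =
      ((if j = l then of_real S * (u $ j * cnj (v $ l)) else 0) -
        (cnj (w $ j) * u $ j) * (cnj (v $ l) * w $ l)) / of_real (S\<^sup>2)" for j l
    using u v by (auto simp: fubini_study_def S_def[symmetric] Let_def algebra_simps)
  then have "(\<Sum>j\<in>UNIV. \<Sum>l\<in>UNIV. fubini_study k w $ j $ l * (u $ j * cnj (v $ l))) =
      (of_real S * (\<Sum>j\<in>UNIV. u $ j * cnj (v $ j)) -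
        (\<Sum>j\<in>UNIV. \<Sum>l\<in>UNIV. (cnj (w $ j) * u $ j) * (cnj (v $ l) * w $ l))) / of_real (S\<^sup>2)"
    by (simp add: sum_divide_distrib[symmetric] sum_subtractf sum_distrib_left)
  also have "\<dots> = (of_real S * cinner v u - cinner w u * cinner v w) / of_real (S\<^sup>2)"
    by (simp add: cinner_def sum_product mult.commute)
  also have "\<dots> = fs_herm w v u"
    by (simp add: fs_herm_def S mult.commute)
  finally show ?thesis .
qed

text \<open>\<open>form11\<close> is \<open>\<i>\<close> times the difference of two conjugate
  values of \<open>fs_herm\<close>. The factor 2 will be matched by the two triangles of a
  cell.\<close>

lemma form11_fubini_study:
  assumes "w $ k = 1" "u $ k = 0" "v $ k = 0"
  shows "form11 (fubini_study k w) u v = 2 * Im (fs_herm w u v)"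
proof -
  have "form11 (fubini_study k w) u v = Re (\<i> * (fs_herm w v u - fs_herm w u v))"
    unfolding form11_def right_diff_distrib sum_subtractf
      fubini_study_bilinear[OF assms] fubini_study_bilinear[OF assms(1,3,2)] ..
  then show ?thesis
    by (simp add: fs_herm_commute[of w v u])
qed

section \<open>Second-order expansion of the phase of a small four-cycle\<close>

lemma tendsto_cinner [tendsto_intros]:
  assumes "(f \<longlongrightarrow> u) F" "(g \<longlongrightarrow> v) F"
  shows "((\<lambda>x. cinner (f x) (g x)) \<longlongrightarrow> cinner u v) F"
  unfolding cinner_def by (intro tendsto_intros assms)

lemma tendsto_fs_herm:
  assumes "(f \<longlongrightarrow> w) F" "(g \<longlongrightarrow> u) F" "(h \<longlongrightarrow> v) F" "w \<noteq> 0"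
  shows "((\<lambda>x. fs_herm (f x) (g x) (h x)) \<longlongrightarrow> fs_herm w u v) F"
  unfolding fs_herm_def by (intro tendsto_intros assms) (use assms in simp)

lemma sgn_eq_exp_Im_Ln:
  assumes "z \<noteq> 0"
  shows "sgn z = exp (\<i> * of_real (Im (Ln z)))"
  using cis_Arg[OF assms] by (simp add: Arg_eq_Im_Ln[OF assms] cis_conv_exp)

text \<open>As \<open>c x\<close> may vanish, the limit of \<open>Ln (1 + z) / z\<close> at 0 cannot
  be composed with \<open>\<epsilon> x * c x\<close> directly. The quotient is completed by the
  value 1 at 0, which makes it continuous there.\<close>

lemma tendsto_Ln_quotient:
  fixes c :: "'a \<Rightarrow> complex"
  assumes \<epsilon>: "(\<epsilon> \<longlongrightarrow> 0) F" and c: "(c \<longlongrightarrow> c0) F" and nz: "\<forall>\<^sub>F x in F. \<epsilon> x \<noteq> 0"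
  shows "((\<lambda>x. Ln (1 + \<epsilon> x * c x) / \<epsilon> x) \<longlongrightarrow> c0) F"
proof -
  define \<phi> :: "complex \<Rightarrow> complex" where "\<phi> z = (if z = 0 then 1 else Ln (1 + z) / z)" for z
  have "(Ln has_field_derivative inverse 1) (at 1)"
    by (intro has_field_derivative_Ln) simp
  then have "((\<lambda>z. Ln (1 + z) / z) \<longlongrightarrow> 1) (at 0)"
    by (simp add: DERIV_def)
  moreover have "\<forall>\<^sub>F z in at 0. Ln (1 + z) / z = \<phi> z"
    by (auto simp: eventually_at_filter \<phi>_def)
  ultimately have "(\<phi> \<longlongrightarrow> 1) (at 0)"
    by (rule Lim_transform_eventually)
  then have "isCont \<phi> 0" by (simp add: isCont_def \<phi>_def)
  moreover have "((\<lambda>x. \<epsilon> x * c x) \<longlongrightarrow> 0) F"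
    using tendsto_mult[OF \<epsilon> c] by simp
  ultimately have "((\<lambda>x. \<phi> (\<epsilon> x * c x)) \<longlongrightarrow> \<phi> 0) F"
    by (rule isCont_tendsto_compose)
  then have "((\<lambda>x. c x * \<phi> (\<epsilon> x * c x)) \<longlongrightarrow> c0 * 1) F"
    by (intro tendsto_mult c) (simp add: \<phi>_def)
  moreover have "\<forall>\<^sub>F x in F. c x * \<phi> (\<epsilon> x * c x) = Ln (1 + \<epsilon> x * c x) / \<epsilon> x"
    using nz by eventually_elim (auto simp: \<phi>_def)
  ultimately show ?thesis
    by (simp add: tendsto_cong)
qed

text \<open>The terms of order 0 and 1 in \<open>\<delta>\<close> cancel exactly, and the numerator
  of \<open>fs_herm\<close> is left over as the quadratic term.\<close>

lemma cinner_ratio_expansion: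
  assumes "cinner (w + \<delta> *\<^sub>R x) w * cinner w (w + \<delta> *\<^sub>R y) \<noteq> 0"
  shows "cinner (w + \<delta> *\<^sub>R x) (w + \<delta> *\<^sub>R y) * cinner w w / (cinner (w + \<delta> *\<^sub>R x) w * cinner w (w + \<delta> *\<^sub>R y)) =
    1 + of_real (\<delta>\<^sup>2) * ((cinner x y * cinner w w - cinner x w * cinner w y) /
      (cinner (w + \<delta> *\<^sub>R x) w * cinner w (w + \<delta> *\<^sub>R y)))"
proof -
  have sc: "cinner (\<delta> *\<^sub>R a) b = of_real \<delta> * cinner a b" "cinner b (\<delta> *\<^sub>R a) = of_real \<delta> * cinner b a" for a b
    using cinner_scale[of "of_real \<delta>" a 1 b] cinner_scale[of 1 b "of_real \<delta>" a] by (simp_all add: vec_smult_eq)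
  have "cinner (w + \<delta> *\<^sub>R x) (w + \<delta> *\<^sub>R y) * cinner w w =
      cinner (w + \<delta> *\<^sub>R x) w * cinner w (w + \<delta> *\<^sub>R y) +
      of_real (\<delta>\<^sup>2) * (cinner x y * cinner w w - cinner x w * cinner w y)"
    by (simp add: cinner_add_left cinner_add_right sc algebra_simps power2_eq_square)
  then show ?thesis
    using assms by (simp add: add_divide_distrib)
qed

text \<open>The phase of a four-cycle based at \<open>w\<close> is the product of the phases of the two triangles into
  which the diagonal from \<open>w\<close> cuts it, and each triangle contributes \<open>fs_herm\<close> to second order.\<close>

lemma cinner_cycle4_split:
  fixes w w1 w2 w3 :: "complex^'k::finite"
  assumes "w \<noteq> 0" "cinner w w1 \<noteq> 0" "cinner w w2 \<noteq> 0" "cinner w w3 \<noteq> 0"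
  shows "sgn (cinner w w1 * cinner w1 w2 * cinner w2 w3 * cinner w3 w) =
    sgn ((cinner w1 w2 * cinner w w / (cinner w1 w * cinner w w2)) *
         (cinner w2 w3 * cinner w w / (cinner w2 w * cinner w w3)))" (is "_ = sgn ?R")
proof -
  \<comment> \<open>The positive factor between the two sides: the three edges from \<open>w\<close>
    give squared moduli, and each of the two triangles uses <w,w> once.\<close>
  define P where "P = (cmod (cinner w w1) * cmod (cinner w w2) * cmod (cinner w w3) / (norm w)\<^sup>2)\<^sup>2"
  have P: "P > 0" using assms by (simp add: P_def)
  have sq: "cinner a b * cinner b a = of_real ((cmod (cinner a b))\<^sup>2)" for a b :: "complex^'k"
    by (subst (2) cinner_commute) (simp only: complex_norm_square)
  have nz: "cinner w1 w \<noteq> 0" "cinner w2 w \<noteq> 0"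
    using assms cinner_commute[of w] by simp_all
  have "cinner w w1 * cinner w1 w2 * cinner w2 w3 * cinner w3 w =
     (cinner w w1 * cinner w1 w) * (cinner w w2 * cinner w2 w) * (cinner w w3 * cinner w3 w) /
       (cinner w w)\<^sup>2 * ?R"
    using assms nz by (simp add: field_simps power2_eq_square)
  also have "\<dots> = P *\<^sub>R ?R"
    unfolding sq unfolding P_def cinner_self
    by (simp add: scaleR_conv_of_real power_mult_distrib power_divide)
  finally show ?thesis
    using P by (simp add: sgn_scaleR)
qed

text \<open>The base point \<open>w p\<close> moves along with the corners. The limit adds the
  contributions of the triangles \<open>w, w1, w2\<close> and \<open>w, w2, w3\<close>; for
  \<open>Y = X + Z\<close> it equals \<open>2 * Im (fs_herm w0 X Z)\<close>.\<close>

lemma cinner_cycle4_phase_limit: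
  fixes w w1 w2 w3 :: "'a \<Rightarrow> complex^'k::finite"
  assumes \<delta>: "(\<delta> \<longlongrightarrow> 0) F" "\<forall>\<^sub>F p in F. \<delta> p > 0" and w: "(w \<longlongrightarrow> w0) F" "w0 \<noteq> 0"
    and X: "((\<lambda>p. (w1 p - w p) /\<^sub>R \<delta> p) \<longlongrightarrow> X) F"
    and Y: "((\<lambda>p. (w2 p - w p) /\<^sub>R \<delta> p) \<longlongrightarrow> Y) F"
    and Z: "((\<lambda>p. (w3 p - w p) /\<^sub>R \<delta> p) \<longlongrightarrow> Z) F"
  shows "\<exists>\<theta>. (\<forall>\<^sub>F p in F. sgn (cinner (w p) (w1 p) * cinner (w1 p) (w2 p) * cinner (w2 p) (w3 p) *
        cinner (w3 p) (w p)) = exp (\<i> * of_real (\<theta> p))) \<and>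
      ((\<lambda>p. \<theta> p / (\<delta> p)\<^sup>2) \<longlongrightarrow> Im (fs_herm w0 X Y) + Im (fs_herm w0 Y Z)) F"
proof -
  define q where "q v p = (v p - w p) /\<^sub>R \<delta> p" for v :: "'a \<Rightarrow> complex^'k" and p
  have q: "\<forall>\<^sub>F p in F. v p = w p + \<delta> p *\<^sub>R q v p" for v
    using \<delta>(2) by eventually_elim (simp add: q_def)
  have lim: "(v \<longlongrightarrow> w0) F" if "(q v \<longlongrightarrow> V) F" for v V
  proof -
    have "((\<lambda>p. w p + \<delta> p *\<^sub>R q v p) \<longlongrightarrow> w0 + 0 *\<^sub>R V) F"
      by (intro tendsto_intros w \<delta> that)
    then show ?thesis
      using q[of v] by (simp add: tendsto_cong)
  qed
  have qs: "(q w1 \<longlongrightarrow> X) F" "(q w2 \<longlongrightarrow> Y) F" "(q w3 \<longlongrightarrow> Z) F"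
    using X Y Z by (simp_all add: q_def[abs_def])
  note lims = qs[THEN lim]
  define c where "c v v' p = (cinner (q v p) (q v' p) * cinner (w p) (w p) -
      cinner (q v p) (w p) * cinner (w p) (q v' p)) / (cinner (v p) (w p) * cinner (w p) (v' p))"
    for v v' p
  have c: "(c v v' \<longlongrightarrow> fs_herm w0 V V') F" if "(q v \<longlongrightarrow> V) F" "(q v' \<longlongrightarrow> V') F" for v v' V V'
    unfolding c_def[abs_def] fs_herm_def power2_eq_square
    by (intro tendsto_intros that w lim[OF that(1)] lim[OF that(2)]) (use w in simp)
  \<comment> \<open>The product of the two triangle factors is 1 plus \<open>C p\<close> times the
    square of \<open>\<delta> p\<close>; its mixed term keeps another such square and vanishes in
    the limit.\<close>
  define C where "C p = c w1 w2 p + c w2 w3 p + of_real ((\<delta> p)\<^sup>2) * (c w1 w2 p * c w2 w3 p)" for p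
  have "((\<lambda>p. c w1 w2 p + c w2 w3 p + of_real ((\<delta> p)\<^sup>2) * (c w1 w2 p * c w2 w3 p)) \<longlongrightarrow>
      fs_herm w0 X Y + fs_herm w0 Y Z + of_real (0\<^sup>2) * (fs_herm w0 X Y * fs_herm w0 Y Z)) F"
    by (intro tendsto_intros c qs \<delta>)
  then have C: "(C \<longlongrightarrow> fs_herm w0 X Y + fs_herm w0 Y Z) F"
    by (simp add: C_def[abs_def])
  have \<delta>2: "((\<lambda>p. complex_of_real ((\<delta> p)\<^sup>2)) \<longlongrightarrow> 0) F"
    using tendsto_of_real[OF tendsto_power[OF \<delta>(1), of 2], where 'a = complex] by simp
  \<comment> \<open>The argument of \<open>Ln\<close> tends to 1, so the principal branch picks out
    the small phase.\<close>
  define \<theta> where "\<theta> p = Im (Ln (1 + of_real ((\<delta> p)\<^sup>2) * C p))" for p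
  have "((\<lambda>p. Ln (1 + of_real ((\<delta> p)\<^sup>2) * C p) / of_real ((\<delta> p)\<^sup>2)) \<longlongrightarrow>
      fs_herm w0 X Y + fs_herm w0 Y Z) F"
    by (rule tendsto_Ln_quotient[OF \<delta>2 C]) (use \<delta>(2) in eventually_elim, simp)
  from tendsto_Im[OF this] have lim\<theta>:
    "((\<lambda>p. \<theta> p / (\<delta> p)\<^sup>2) \<longlongrightarrow> Im (fs_herm w0 X Y) + Im (fs_herm w0 Y Z)) F"
    by (simp add: \<theta>_def Im_divide_of_real del: of_real_power)
  have nz: "\<forall>\<^sub>F p in F. cinner (w p) (v p) \<noteq> 0" if "(v \<longlongrightarrow> w0) F" for v
    using tendsto_imp_eventually_ne[OF tendsto_cinner[OF w(1) that], of 0] w(2) by simp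
  have "((\<lambda>p. 1 + of_real ((\<delta> p)\<^sup>2) * C p) \<longlongrightarrow> 1 + 0 * (fs_herm w0 X Y + fs_herm w0 Y Z)) F"
    by (intro tendsto_intros C \<delta>2)
  then have nzC: "\<forall>\<^sub>F p in F. 1 + of_real ((\<delta> p)\<^sup>2) * C p \<noteq> 0"
    by (intro tendsto_imp_eventually_ne) auto
  have "\<forall>\<^sub>F p in F. sgn (cinner (w p) (w1 p) * cinner (w1 p) (w2 p) * cinner (w2 p) (w3 p) *
        cinner (w3 p) (w p)) = exp (\<i> * of_real (\<theta> p))"
    using nz[OF w(1)] nz[OF lims(1)] nz[OF lims(2)] nz[OF lims(3)] nzC q[of w1] q[of w2] q[of w3]
  proof eventually_elim
    case (elim p)
    have nz': "cinner (v p) (w p) \<noteq> 0" if "cinner (w p) (v p) \<noteq> 0" for v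
      using that cinner_commute[of "w p" "v p"] by simp
    have ratio: "cinner (v p) (v' p) * cinner (w p) (w p) / (cinner (v p) (w p) * cinner (w p) (v' p)) =
        1 + of_real ((\<delta> p)\<^sup>2) * c v v' p"
      if "v p = w p + \<delta> p *\<^sub>R q v p" "v' p = w p + \<delta> p *\<^sub>R q v' p"
        "cinner (w p) (v p) \<noteq> 0" "cinner (w p) (v' p) \<noteq> 0" for v v'
      using cinner_ratio_expansion[of "w p" "\<delta> p" "q v p" "q v' p", folded that(1,2)]
        that(4) nz'[of v] that(3) unfolding c_def by simp
    have "sgn (cinner (w p) (w1 p) * cinner (w1 p) (w2 p) * cinner (w2 p) (w3 p) * cinner (w3 p) (w p)) =
        sgn ((1 + of_real ((\<delta> p)\<^sup>2) * c w1 w2 p) * (1 + of_real ((\<delta> p)\<^sup>2) * c w2 w3 p))"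
      unfolding ratio[OF elim(6,7,2,3), symmetric] ratio[OF elim(7,8,3,4), symmetric]
      by (rule cinner_cycle4_split) (use elim(1-4) in auto)
    also have "(1 + of_real ((\<delta> p)\<^sup>2) * c w1 w2 p) * (1 + of_real ((\<delta> p)\<^sup>2) * c w2 w3 p) =
        1 + of_real ((\<delta> p)\<^sup>2) * C p"
      by (simp add: C_def algebra_simps)
    finally show ?case
      using sgn_eq_exp_Im_Ln[OF elim(5)] by (simp add: \<theta>_def)
  qed
  with lim\<theta> show ?thesis by blast
qed

section \<open>Surfaces in affine charts\<close>

abbreviation unit_square :: "(real \<times> real) set" where
  "unit_square \<equiv> {0..1} \<times> {0..1}"

section \<open>Affine coordinates and their changes\<close>

lemma affine_coordD:
  assumes "p \<in> affine_domain k"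
  shows "affine_coord k p \<in> p" "affine_coord k p $ k = 1" "p \<in> proj_space" "affine_coord k p \<noteq> 0"
proof -
  obtain u v where p: "p \<in> proj_space" "u \<in> p" "u $ k \<noteq> 0" "p = proj_point v"
    using assms unfolding affine_domain_def proj_space_def by blast
  then have "p = proj_point u"
    by (intro proj_space_nonzero_member) auto
  then have *: "w \<in> p \<and> w $ k = 1 \<longleftrightarrow> w = inverse (u $ k) *s u" for w
    using p(3) unfolding proj_point_def by (auto simp: divide_eq_eq field_simps)
  have "affine_coord k p = inverse (u $ k) *s u"
    unfolding affine_coord_def * by simp
  then show "affine_coord k p \<in> p" "affine_coord k p $ k = 1" "p \<in> proj_space"
    using *[of "affine_coord k p"] p(1) by auto
  then show "affine_coord k p \<noteq> 0" by auto
qed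

lemma affine_coord_unique:
  assumes "p \<in> affine_domain k" "w \<in> p" "w $ k = 1"
  shows "affine_coord k p = w"
proof -
  note p = affine_coordD[OF assms(1)]
  have "p = proj_point (affine_coord k p)"
    by (rule proj_space_nonzero_member[OF p(3,1,4)])
  then obtain a where a: "w = a *s affine_coord k p"
    using assms(2) unfolding proj_point_def by blast
  then have "a = 1" using assms(3) p(2) by simp
  then show ?thesis using a by simp
qed

lemma affine_coord_change:
  assumes p: "p \<in> affine_domain k" and nz: "affine_coord k p $ l \<noteq> 0"
  shows "p \<in> affine_domain l" "affine_coord l p = inverse (affine_coord k p $ l) *s affine_coord k p"
proof -
  note P = affine_coordD[OF p]
  show l: "p \<in> affine_domain l"
    using P nz unfolding affine_domain_def by blast
  have "p = proj_point (affine_coord k p)"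
    by (rule proj_space_nonzero_member[OF P(3,1,4)])
  then have "inverse (affine_coord k p $ l) *s affine_coord k p \<in> p"
    unfolding proj_point_def by blast
  then show "affine_coord l p = inverse (affine_coord k p $ l) *s affine_coord k p"
    using nz by (intro affine_coord_unique[OF l]) auto
qed

lemma affine_coord_nonzero:
  assumes "p \<in> affine_domain k" "p \<in> affine_domain l"
  shows "affine_coord k p $ l \<noteq> 0"
proof
  assume z: "affine_coord k p $ l = 0"
  note P = affine_coordD[OF assms(1)]
  have "p = proj_point (affine_coord k p)"
    by (rule proj_space_nonzero_member[OF P(3,1,4)])
  then obtain a where "affine_coord l p = a *s affine_coord k p"
    using affine_coordD(1)[OF assms(2)] unfolding proj_point_def by blast
  then show False using affine_coordD(2)[OF assms(2)] z by simp
qed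

lemma bounded_bilinear_vector_scalar_mult:
  "bounded_bilinear ((*s) :: complex \<Rightarrow> complex^'k::finite \<Rightarrow> complex^'k)"
proof
  show "\<exists>K. \<forall>a b. norm (a *s b :: complex^'k) \<le> norm a * norm b * K"
    by (rule exI[of _ 1]) (simp add: norm_vector_scalar_mult)
qed (simp_all add: vec_eq_iff algebra_simps)

text \<open>The derivative has the shape \<open>a *s w + f *s x\<close> with
  \<open>f = inverse (c s $ l)\<close>, to which \<open>fs_herm_rescale\<close> applies.\<close>

lemma has_vector_derivative_affine_change:
  fixes c :: "real \<Rightarrow> complex^'k::finite"
  assumes c: "(c has_vector_derivative c') (at s within S)" and nz: "c s $ l \<noteq> 0"
  shows "((\<lambda>r. inverse (c r $ l) *s c r) has_vector_derivative
      (- (inverse (c s $ l) * c' $ l * inverse (c s $ l))) *s c s + inverse (c s $ l) *s c') (at s within S)"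
proof -
  have comp: "((\<lambda>r. c r $ l) has_vector_derivative c' $ l) (at s within S)"
    by (rule bounded_linear.has_vector_derivative[OF bounded_linear_vec_nth c])
  have "((\<lambda>r. inverse (c r $ l)) has_vector_derivative
      - (inverse (c s $ l) * c' $ l * inverse (c s $ l))) (at s within S)"
    using Deriv.has_derivative_inverse[OF nz comp[unfolded has_vector_derivative_def]]
    unfolding has_vector_derivative_def by (simp add: algebra_simps)
  from bounded_bilinear.has_vector_derivative[OF bounded_bilinear_vector_scalar_mult this c]
  show ?thesis by (simp add: add.commute)
qed

text \<open>Strict differentiability: both points of the difference may vary near \<open>x0\<close>,
  as the corners of a cell do. It follows from the mean value inequality on a convex set for
  \<open>W - D x0\<close>, whose derivative is small near \<open>x0\<close>.\<close>

lemma strictly_differentiable_within: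
  fixes W :: "real \<times> real \<Rightarrow> 'b::real_normed_vector"
  assumes Q: "convex Q" and V: "open V" "x0 \<in> V \<inter> Q"
    and D: "\<And>y. y \<in> V \<inter> Q \<Longrightarrow> (W has_derivative D y) (at y within Q)"
    and cont: "\<And>v. continuous_on (V \<inter> Q) (\<lambda>y. D y v)" and e: "e > 0"
  obtains r where "r > 0"
    "\<And>a b. a \<in> ball x0 r \<inter> Q \<Longrightarrow> b \<in> ball x0 r \<inter> Q \<Longrightarrow> norm (W b - W a - D x0 (b - a)) \<le> e * norm (b - a)"
proof -
  obtain r0 where r0: "r0 > 0" "ball x0 r0 \<subseteq> V"
    using V open_contains_ball by blast
  \<comment> \<open>Continuity of the derivative is given for each fixed direction only; the two
    coordinate directions, each with half of \<open>e\<close>, control the operator norm.\<close>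
  have close: "\<exists>r>0. \<forall>y\<in>V \<inter> Q. dist y x0 < r \<longrightarrow> norm (D y v - D x0 v) < e / 2" for v
    using cont[of v] V(2) half_gt_zero[OF e] unfolding continuous_on_iff dist_norm by blast
  obtain r1 where r1: "r1 > 0" "\<forall>y\<in>V \<inter> Q. dist y x0 < r1 \<longrightarrow> norm (D y (1, 0) - D x0 (1, 0)) < e / 2"
    using close by blast
  obtain r2 where r2: "r2 > 0" "\<forall>y\<in>V \<inter> Q. dist y x0 < r2 \<longrightarrow> norm (D y (0, 1) - D x0 (0, 1)) < e / 2"
    using close by blast
  define r where "r = min r0 (min r1 r2)"
  let ?B = "ball x0 r \<inter> Q"
  have B: "y \<in> V \<inter> Q" "dist y x0 < r1" "dist y x0 < r2" if "y \<in> ?B" for y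
    using that r0 by (auto simp: r_def dist_commute)
  have lin: "bounded_linear (D y)" if "y \<in> V \<inter> Q" for y
    using D[OF that] by (rule has_derivative_bounded_linear)
  have der: "((\<lambda>y. W y - D x0 y) has_derivative (\<lambda>v. D y v - D x0 v)) (at y within ?B)" if "y \<in> ?B" for y
    by (intro has_derivative_diff has_derivative_subset[OF D[OF B(1)[OF that]]]
        bounded_linear_imp_has_derivative lin V) auto
  have onorm: "onorm (\<lambda>v. D y v - D x0 v) \<le> e" if y: "y \<in> ?B" for y
  proof (rule onorm_bound)
    fix v :: "real \<times> real"
    note L = lin[OF B(1)[OF y]] lin[OF V(2)]
    have v: "v = fst v *\<^sub>R (1, 0) + snd v *\<^sub>R (0, 1)" by (simp add: prod_eq_iff)
    have ex: "D z v = fst v *\<^sub>R D z (1, 0) + snd v *\<^sub>R D z (0, 1)" if "bounded_linear (D z)" for z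
    proof -
      interpret bounded_linear "D z" by fact
      show ?thesis by (subst v) (simp only: add scaleR)
    qed
    have "D y v - D x0 v = fst v *\<^sub>R (D y (1, 0) - D x0 (1, 0)) + snd v *\<^sub>R (D y (0, 1) - D x0 (0, 1))"
      unfolding ex[OF L(1)] ex[OF L(2)] by (simp add: algebra_simps)
    also have "norm \<dots> \<le> \<bar>fst v\<bar> * norm (D y (1, 0) - D x0 (1, 0)) + \<bar>snd v\<bar> * norm (D y (0, 1) - D x0 (0, 1))"
      by (rule order_trans[OF norm_triangle_ineq]) simp
    also have "\<dots> \<le> norm v * (e / 2) + norm v * (e / 2)"
    proof (intro add_mono mult_mono)
      show "\<bar>fst v\<bar> \<le> norm v" "\<bar>snd v\<bar> \<le> norm v"
        using norm_fst_le[of "fst v" "snd v"] norm_snd_le[of "snd v" "fst v"] by simp_all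
      show "norm (D y (1, 0) - D x0 (1, 0)) \<le> e / 2" "norm (D y (0, 1) - D x0 (0, 1)) \<le> e / 2"
        using r1(2) r2(2) B[OF y] less_imp_le by blast+
    qed auto
    finally show "norm (D y v - D x0 v) \<le> e * norm v"
      by (simp add: mult.commute)
  qed (use e in simp)
  show thesis
  proof
    show "r > 0" using r0 r1 r2 by (simp add: r_def)
    fix a b assume a: "a \<in> ?B" and b: "b \<in> ?B"
    have le: "norm ((W b - D x0 b) - (W a - D x0 a)) \<le> e * norm (b - a)"
      by (rule differentiable_bound[OF _ der onorm b a]) (intro convex_Int convex_ball Q)
    have "D x0 (b - a) = D x0 b - D x0 a"
      using bounded_linear.linear[OF lin[OF V(2)]] by (rule linear_diff)
    then have "W b - W a - D x0 (b - a) = (W b - D x0 b) - (W a - D x0 a)"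
      by (simp only:) (simp add: algebra_simps)
    with le show "norm (W b - W a - D x0 (b - a)) \<le> e * norm (b - a)"
      by (simp only:)
  qed
qed

text \<open>Lower left corner and side length of the squares contained in the unit square.\<close>

definition cells :: "((real \<times> real) \<times> real) set" where
  "cells = {(x, d). 0 < d \<and> x \<in> unit_square \<and> x + (d, d) \<in> unit_square}"

lemma cells_corner:
  assumes "(x, d) \<in> cells" "0 \<le> a" "a \<le> 1" "0 \<le> b" "b \<le> 1"
  shows "x + d *\<^sub>R (a, b) \<in> unit_square"
proof -
  obtain p q where x: "x = (p, q)" by fastforce
  have pq: "0 < d" "0 \<le> p" "p + d \<le> 1" "0 \<le> q" "q + d \<le> 1"
    using assms(1) by (auto simp: x cells_def)
  then have "0 \<le> d * a" "d * a \<le> d" "0 \<le> d * b" "d * b \<le> d"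
    using assms by (auto simp: mult_left_le)
  then have "0 \<le> p + d * a" "p + d * a \<le> 1" "0 \<le> q + d * b" "q + d * b \<le> 1"
    using pq by linarith+
  then show ?thesis by (simp add: x)
qed

lemma eventually_cells:
  "eventually (\<lambda>c. c \<in> cells) (at (x0, 0) within cells)"
  by (simp add: eventually_at_filter)

text \<open>In the filter \<open>at (x0, 0) within cells\<close> the corner and the side length of a
  cell vary independently, so a limit along it is an estimate uniform over all small cells near
  \<open>x0\<close>.\<close>

lemma tendsto_cell_difference_quotient:
  fixes W :: "real \<times> real \<Rightarrow> 'b::real_normed_vector"
  assumes V: "open V" "x0 \<in> V \<inter> unit_square"
    and D: "\<And>y. y \<in> V \<inter> unit_square \<Longrightarrow> (W has_derivative D y) (at y within unit_square)"
    and cont: "\<And>v. continuous_on (V \<inter> unit_square) (\<lambda>y. D y v)"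
    and ab: "0 \<le> a" "a \<le> 1" "0 \<le> b" "b \<le> 1"
  shows "((\<lambda>c. (W (fst c + snd c *\<^sub>R (a, b)) - W (fst c)) /\<^sub>R snd c) \<longlongrightarrow> D x0 (a, b))
    (at (x0, 0) within cells)"
proof (rule tendstoI)
  fix e :: real assume e: "e > 0"
  have cQ: "convex unit_square" by (intro convex_Times convex_closed_interval)
  \<comment> \<open>The increment inside a cell of side \<open>d\<close> has norm at most
    \<open>2 * d\<close>. This turns \<open>e / 3\<close> into \<open>2 * e / 3\<close>, and
    distances below \<open>r / 3\<close> keep both points within \<open>r\<close> of
    \<open>x0\<close>.\<close>
  obtain r where r: "r > 0" "\<And>a b. a \<in> ball x0 r \<inter> unit_square \<Longrightarrow> b \<in> ball x0 r \<inter> unit_square \<Longrightarrow>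
      norm (W b - W a - D x0 (b - a)) \<le> (e / 3) * norm (b - a)"
    using strictly_differentiable_within[OF cQ V D cont, of "e / 3"] e by auto
  have nab: "norm (a, b) \<le> 2"
    using norm_Pair_le[of a b] ab by simp
  have "\<forall>\<^sub>F c in at (x0, 0) within cells. dist c (x0, 0) < r / 3"
    unfolding eventually_at by (rule exI[of _ "r / 3"]) (use r(1) in simp)
  then show "\<forall>\<^sub>F c in at (x0, 0) within cells.
      dist ((W (fst c + snd c *\<^sub>R (a, b)) - W (fst c)) /\<^sub>R snd c) (D x0 (a, b)) < e"
    using eventually_cells
  proof eventually_elim
    case (elim c)
    obtain x d where c: "c = (x, d)" by fastforce
    let ?y = "x + d *\<^sub>R (a, b)"
    have d: "d > 0" and x: "x \<in> unit_square" using elim(2) c by (auto simp: cells_def)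
    have y: "?y \<in> unit_square" using cells_corner[OF elim(2)[unfolded c] ab] .
    have dx: "dist x x0 < r / 3" "\<bar>d\<bar> < r / 3"
      using elim(1) dist_fst_le[of c "(x0, 0)"] dist_snd_le[of c "(x0, 0)"] by (auto simp: c dist_real_def)
    have "dist ?y x0 \<le> dist ?y x + dist x x0" by (rule dist_triangle)
    also have "dist ?y x = d * norm (a, b)" using d by (simp add: dist_norm del: scaleR_Pair)
    also have "\<dots> \<le> d * 2" using nab d by (intro mult_left_mono) auto
    finally have "dist ?y x0 < r" using dx d by simp
    then have yB: "?y \<in> ball x0 r \<inter> unit_square" using y by (simp add: dist_commute)
    have xB: "x \<in> ball x0 r \<inter> unit_square" using x dx r(1) by (simp add: dist_commute)
    have lin: "bounded_linear (D x0)"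
      using D[OF V(2)] by (rule has_derivative_bounded_linear)
    have "norm (W ?y - W x - D x0 (d *\<^sub>R (a, b))) \<le> (e / 3) * norm (d *\<^sub>R (a, b))"
      using r(2)[OF xB yB] by simp
    also have "D x0 (d *\<^sub>R (a, b)) = d *\<^sub>R D x0 (a, b)"
      by (rule linear_cmul[OF bounded_linear.linear[OF lin]])
    also have "norm (d *\<^sub>R (a, b)) \<le> d * 2"
      unfolding norm_scaleR using nab d by (simp add: mult_left_mono)
    finally have le: "norm (W ?y - W x - d *\<^sub>R D x0 (a, b)) \<le> (e / 3) * (d * 2)"
      using e by simp
    have "(W ?y - W x) /\<^sub>R d - D x0 (a, b) = (W ?y - W x - d *\<^sub>R D x0 (a, b)) /\<^sub>R d"
      using d by (simp add: algebra_simps)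
    then have "dist ((W ?y - W x) /\<^sub>R d) (D x0 (a, b)) = norm (W ?y - W x - d *\<^sub>R D x0 (a, b)) / d"
      using d by (simp add: dist_norm divide_inverse mult.commute)
    also have "\<dots> \<le> (e / 3) * 2"
      using le d by (simp add: field_simps)
    also have "\<dots> < e" using e by simp
    finally show ?case by (simp add: c)
  qed
qed

section \<open>The pull-back of the Fubini-Study form in a chart\<close>

definition C1_chart :: "(real \<Rightarrow> real \<Rightarrow> 'k::finite point) \<Rightarrow> 'k \<Rightarrow> (real \<times> real) set \<Rightarrow>
    (real \<times> real \<Rightarrow> real \<times> real \<Rightarrow> complex^'k) \<Rightarrow> bool" where
  "C1_chart \<sigma> k V D \<longleftrightarrow> open V \<and>
     (\<forall>y\<in>V \<inter> unit_square. case_prod \<sigma> y \<in> affine_domain k \<and>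
        ((\<lambda>y. affine_coord k (case_prod \<sigma> y)) has_derivative D y) (at y within unit_square)) \<and>
     (\<forall>v. continuous_on (V \<inter> unit_square) (\<lambda>y. D y v))"

lemma C1_surface_chart:
  assumes "C1_surface \<sigma>" "x \<in> unit_square"
  obtains k V D where "C1_chart \<sigma> k V D" "x \<in> V \<inter> unit_square"
proof -
  from bspec[OF assms(1)[unfolded C1_surface_def] assms(2)]
  obtain k V D where "open V" "x \<in> V"
    "\<forall>y\<in>V \<inter> unit_square. case_prod \<sigma> y \<in> affine_domain k \<and>
       ((\<lambda>y. affine_coord k (case_prod \<sigma> y)) has_derivative D y) (at y within unit_square)"
    "\<forall>v. continuous_on (V \<inter> unit_square) (\<lambda>y. D y v)"
    by (elim exE conjE)
  then show thesis
    using assms(2) by (intro that[of k V D]) (simp_all add: C1_chart_def)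
qed

text \<open>The curve is known to lie in the chart \<open>l\<close> at \<open>s\<close> only; near
  \<open>s\<close> this follows because coordinate \<open>l\<close> stays nonzero by continuity. At
  the ends of the interval the derivative is one-sided.\<close>

lemma affine_coord_curve_derivative:
  fixes g :: "real \<Rightarrow> 'k::finite point"
  assumes s: "s \<in> {0..1}" and der: "((\<lambda>r. affine_coord k (g r)) has_vector_derivative A) (at s within {0..1})"
    and dom: "\<forall>\<^sub>F r in at s within {0..1}. g r \<in> affine_domain k" "g s \<in> affine_domain k"
    and l: "g s \<in> affine_domain l"
  defines "w \<equiv> affine_coord k (g s)"
  shows "vector_derivative (\<lambda>r. affine_coord l (g r)) (at s within {0..1}) =
    (- (inverse (w $ l) * A $ l * inverse (w $ l))) *s w + inverse (w $ l) *s A"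
proof -
  let ?c = "\<lambda>r. affine_coord k (g r)"
  have nz: "?c s $ l \<noteq> 0"
    using affine_coord_nonzero[OF dom(2) l] .
  have "continuous (at s within {0..1}) ?c"
    by (rule has_vector_derivative_continuous[OF der])
  then have "((\<lambda>r. ?c r $ l) \<longlongrightarrow> ?c s $ l) (at s within {0..1})"
    unfolding continuous_within by (rule tendsto_vec_nth)
  then have "\<forall>\<^sub>F r in at s within {0..1}. ?c r $ l \<noteq> 0"
    using nz by (rule tendsto_imp_eventually_ne)
  with dom(1) have ev: "\<forall>\<^sub>F r in at s within {0..1}. affine_coord l (g r) = inverse (?c r $ l) *s ?c r"
    by eventually_elim (rule affine_coord_change(2))
  then obtain d where d: "d > 0"
    "\<And>r. r \<in> {0..1} \<Longrightarrow> r \<noteq> s \<Longrightarrow> dist r s < d \<Longrightarrow> affine_coord l (g r) = inverse (?c r $ l) *s ?c r"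
    unfolding eventually_at by blast
  have "((\<lambda>r. affine_coord l (g r)) has_vector_derivative
      (- (inverse (w $ l) * A $ l * inverse (w $ l))) *s w + inverse (w $ l) *s A) (at s within {0..1})"
    unfolding w_def
  proof (rule has_vector_derivative_transform_within[OF has_vector_derivative_affine_change[OF der nz] d(1) s])
    fix r assume "r \<in> {0..1}" "dist r s < d"
    then show "inverse (?c r $ l) *s ?c r = affine_coord l (g r)"
      using d(2) affine_coord_change(2)[OF dom(2) nz] by (cases "r = s") auto
  qed
  then show ?thesis
    using s by (intro vector_derivative_within_closed_interval) auto
qed

text \<open>\<open>fubini_study_pullback\<close> picks an affine chart by \<open>SOME\<close> at
  every point separately, which hides its continuity. Here it is expressed in one chart over all of
  \<open>V\<close>.\<close>

lemma fubini_study_pullback_chart: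
  assumes ch: "C1_chart \<sigma> k V D" and y: "(s, t) \<in> V \<inter> unit_square"
  shows "fubini_study_pullback \<sigma> s t =
    2 * Im (fs_herm (affine_coord k (\<sigma> s t)) (D (s, t) (1, 0)) (D (s, t) (0, 1)))"
proof -
  have V: "open V" and dom: "\<And>y. y \<in> V \<inter> unit_square \<Longrightarrow> case_prod \<sigma> y \<in> affine_domain k"
    and D: "((\<lambda>y. affine_coord k (case_prod \<sigma> y)) has_derivative D (s, t)) (at (s, t) within unit_square)"
    using ch y unfolding C1_chart_def by blast+
  have st: "s \<in> {0..1}" "t \<in> {0..1}" and yV: "(s, t) \<in> V" using y by auto
  have dst: "\<sigma> s t \<in> affine_domain k" using dom[OF y] by simp
  have lin: "D (s, t) (h *\<^sub>R v) = h *\<^sub>R D (s, t) v" for h v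
    by (rule linear_cmul[OF bounded_linear.linear[OF has_derivative_bounded_linear[OF D]]])
  have d1: "((\<lambda>r. affine_coord k (\<sigma> r t)) has_vector_derivative D (s, t) (1, 0)) (at s within {0..1})"
  proof -
    have "((\<lambda>r. (r, t)) has_derivative (\<lambda>h. (h, 0))) (at s within {0..1})"
      by (auto intro!: derivative_eq_intros)
    moreover have "((\<lambda>y. affine_coord k (case_prod \<sigma> y)) has_derivative D (s, t))
        (at (s, t) within (\<lambda>r. (r, t)) ` {0..1})"
      by (rule has_derivative_subset[OF D]) (use st in auto)
    ultimately have "((\<lambda>r. affine_coord k (case_prod \<sigma> (r, t))) has_derivative (\<lambda>h. D (s, t) (h, 0)))
        (at s within {0..1})"
      by (rule has_derivative_in_compose)
    moreover have "(\<lambda>h. D (s, t) (h, 0)) = (\<lambda>h. h *\<^sub>R D (s, t) (1, 0))"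
      unfolding lin[symmetric] by simp
    ultimately show ?thesis
      unfolding has_vector_derivative_def by (simp only: case_prod_conv)
  qed
  have d2: "((\<lambda>r. affine_coord k (\<sigma> s r)) has_vector_derivative D (s, t) (0, 1)) (at t within {0..1})"
  proof -
    have "((\<lambda>r. (s, r)) has_derivative (\<lambda>h. (0, h))) (at t within {0..1})"
      by (auto intro!: derivative_eq_intros)
    moreover have "((\<lambda>y. affine_coord k (case_prod \<sigma> y)) has_derivative D (s, t))
        (at (s, t) within (\<lambda>r. (s, r)) ` {0..1})"
      by (rule has_derivative_subset[OF D]) (use st in auto)
    ultimately have "((\<lambda>r. affine_coord k (case_prod \<sigma> (s, r))) has_derivative (\<lambda>h. D (s, t) (0, h)))
        (at t within {0..1})"
      by (rule has_derivative_in_compose)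
    moreover have "(\<lambda>h. D (s, t) (0, h)) = (\<lambda>h. h *\<^sub>R D (s, t) (0, 1))"
      unfolding lin[symmetric] by simp
    ultimately show ?thesis
      unfolding has_vector_derivative_def by (simp only: case_prod_conv)
  qed
  have o1: "open ((\<lambda>r. (r, t)) -` V)" and o2: "open ((\<lambda>r. (s, r)) -` V)"
    by (auto intro!: open_vimage V continuous_intros)
  have e1: "\<forall>\<^sub>F r in at s within {0..1}. \<sigma> r t \<in> affine_domain k"
    unfolding eventually_at_topological
    by (rule exI[of _ "(\<lambda>r. (r, t)) -` V"]) (use o1 yV st dom in fastforce)
  have e2: "\<forall>\<^sub>F r in at t within {0..1}. \<sigma> s r \<in> affine_domain k"
    unfolding eventually_at_topological
    by (rule exI[of _ "(\<lambda>r. (s, r)) -` V"]) (use o2 yV st dom in fastforce)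
  define l where "l = (SOME l. \<sigma> s t \<in> affine_domain l)"
  have l: "\<sigma> s t \<in> affine_domain l"
    unfolding l_def using dst by (rule someI)
  let ?w = "affine_coord k (\<sigma> s t)" and ?A = "D (s, t) (1, 0)" and ?B = "D (s, t) (0, 1)"
  let ?f = "inverse (?w $ l)"
  let ?A' = "(- (?f * ?A $ l * ?f)) *s ?w + ?f *s ?A" and ?B' = "(- (?f * ?B $ l * ?f)) *s ?w + ?f *s ?B"
  have nz: "?w $ l \<noteq> 0" by (rule affine_coord_nonzero[OF dst l])
  have "fubini_study_pullback \<sigma> s t = form11 (fubini_study l (affine_coord l (\<sigma> s t))) ?A' ?B'"
    unfolding fubini_study_pullback_def Let_def l_def[symmetric]
      affine_coord_curve_derivative[OF st(1) d1 e1 dst l] affine_coord_curve_derivative[OF st(2) d2 e2 dst l] ..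
  also have "\<dots> = form11 (fubini_study l (?f *s ?w)) ?A' ?B'"
    by (simp only: affine_coord_change(2)[OF dst nz])
  also have "\<dots> = 2 * Im (fs_herm (?f *s ?w) ?A' ?B')"
    by (rule form11_fubini_study) (use nz in \<open>simp_all add: field_simps\<close>)
  also have "\<dots> = 2 * Im (fs_herm ?w ?A ?B)"
    using nz affine_coordD(4)[OF dst] by (subst fs_herm_rescale) auto
  finally show ?thesis .
qed

lemma C1_chart_continuous:
  assumes ch: "C1_chart \<sigma> k V D"
  shows "continuous_on (V \<inter> unit_square) (\<lambda>y. affine_coord k (case_prod \<sigma> y))"
proof -
  have "continuous (at y within V \<inter> unit_square) (\<lambda>y. affine_coord k (case_prod \<sigma> y))"
    if "y \<in> V \<inter> unit_square" for y
  proof -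
    have "((\<lambda>y. affine_coord k (case_prod \<sigma> y)) has_derivative D y) (at y within unit_square)"
      using ch that unfolding C1_chart_def by blast
    then show ?thesis
      by (intro continuous_within_subset[OF has_derivative_continuous]) auto
  qed
  then show ?thesis by (simp add: continuous_on_eq_continuous_within)
qed

lemma continuous_on_fubini_study_pullback:
  assumes \<sigma>: "C1_surface \<sigma>"
  shows "continuous_on unit_square (\<lambda>(s, t). fubini_study_pullback \<sigma> s t)"
proof -
  have "continuous (at x within unit_square) (\<lambda>(s, t). fubini_study_pullback \<sigma> s t)"
    if x: "x \<in> unit_square" for x
  proof -
    obtain k V D where ch: "C1_chart \<sigma> k V D" and xV: "x \<in> V \<inter> unit_square"
      using C1_surface_chart[OF \<sigma> x] .
    have V: "open V" and cD: "\<And>v. continuous_on (V \<inter> unit_square) (\<lambda>y. D y v)"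
      and dom: "\<And>y. y \<in> V \<inter> unit_square \<Longrightarrow> case_prod \<sigma> y \<in> affine_domain k"
      using ch unfolding C1_chart_def by blast+
    have "continuous_on (V \<inter> unit_square)
        (\<lambda>y. 2 * Im (fs_herm (affine_coord k (case_prod \<sigma> y)) (D y (1, 0)) (D y (0, 1))))"
      unfolding continuous_on_def
    proof (intro ballI tendsto_intros tendsto_fs_herm)
      fix y assume y: "y \<in> V \<inter> unit_square"
      show "((\<lambda>y. affine_coord k (case_prod \<sigma> y)) \<longlongrightarrow> affine_coord k (case_prod \<sigma> y)) (at y within V \<inter> unit_square)"
        using C1_chart_continuous[OF ch] y unfolding continuous_on_def by blast
      show "((\<lambda>y. D y v) \<longlongrightarrow> D y v) (at y within V \<inter> unit_square)" for v
        using cD[of v] y unfolding continuous_on_def by blast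
      then show "((\<lambda>y. D y (0, 1)) \<longlongrightarrow> D y (0, 1)) (at y within V \<inter> unit_square)" by blast
      show "affine_coord k (case_prod \<sigma> y) \<noteq> 0"
        by (rule affine_coordD(4)[OF dom[OF y]])
    qed
    then have "continuous_on (V \<inter> unit_square) (\<lambda>(s, t). fubini_study_pullback \<sigma> s t)"
      by (rule continuous_on_eq) (use fubini_study_pullback_chart[OF ch] in auto)
    then have "continuous (at x within V \<inter> unit_square) (\<lambda>(s, t). fubini_study_pullback \<sigma> s t)"
      using xV by (simp add: continuous_on_eq_continuous_within)
    moreover have "at x within V \<inter> unit_square = at x within unit_square"
      by (rule at_within_nhd[of x V]) (use V xV in auto)
    ultimately show ?thesis by simp
  qed
  then show ?thesis by (simp add: continuous_on_eq_continuous_within)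
qed

section \<open>Discrete Stokes theorem\<close>

text \<open>The corners are taken counterclockwise, so that adjacent cells run through their common
  edge in opposite directions.\<close>

definition cell_phase :: "(real \<Rightarrow> real \<Rightarrow> 'k::finite point) \<Rightarrow> real \<times> real \<Rightarrow> real \<Rightarrow> complex" where
  "cell_phase \<sigma> x d =
     (let \<rho> = case_prod \<sigma>; p0 = \<rho> x; p1 = \<rho> (x + d *\<^sub>R (1, 0)); p2 = \<rho> (x + d *\<^sub>R (1, 1));
          p3 = \<rho> (x + d *\<^sub>R (0, 1))
      in link_phase p0 p1 * link_phase p1 p2 * link_phase p2 p3 * link_phase p3 p0)"

lemma norm_cell_phase_le: "norm (cell_phase \<sigma> x d) \<le> 1"
  unfolding cell_phase_def Let_def norm_mult
  by (intro mult_le_one mult_nonneg_nonneg norm_link_phase_le norm_ge_zero)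

lemma norm_exp_i_diff_le: "cmod (exp (\<i> * of_real a) - exp (\<i> * of_real b)) \<le> \<bar>a - b\<bar>"
proof -
  have "exp (\<i> * of_real a) - exp (\<i> * of_real b) =
      exp (\<i> * of_real b) * (exp (\<i> * of_real (a - b)) - 1)"
    by (simp add: algebra_simps exp_add[symmetric])
  then have "cmod (exp (\<i> * of_real a) - exp (\<i> * of_real b)) = 2 * \<bar>sin ((a - b) / 2)\<bar>"
    by (simp only: norm_mult norm_exp_i_times dist_exp_i_1)
  also have "\<dots> \<le> \<bar>a - b\<bar>"
    using abs_sin_x_le_abs_x[of "(a - b) / 2"] by simp
  finally show ?thesis .
qed

lemma cell_integral_limit:
  fixes P :: "real \<times> real \<Rightarrow> real"
  assumes P: "continuous_on unit_square P" and x0: "x0 \<in> unit_square"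
  shows "((\<lambda>c. integral (cbox (fst c) (fst c + (snd c, snd c))) P / (snd c)\<^sup>2) \<longlongrightarrow> P x0)
    (at (x0, 0) within cells)"
proof (rule tendstoI)
  fix e :: real assume e: "e > 0"
  obtain r where r: "r > 0" "\<And>y. y \<in> unit_square \<Longrightarrow> dist y x0 < r \<Longrightarrow> dist (P y) (P x0) < e / 2"
    using P x0 half_gt_zero[OF e] unfolding continuous_on_iff by blast
  have "\<forall>\<^sub>F c in at (x0, 0) within cells. dist c (x0, 0) < r / 3"
    unfolding eventually_at by (rule exI[of _ "r / 3"]) (use r(1) in simp)
  then show "\<forall>\<^sub>F c in at (x0, 0) within cells.
      dist (integral (cbox (fst c) (fst c + (snd c, snd c))) P / (snd c)\<^sup>2) (P x0) < e"
    using eventually_cells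
  proof eventually_elim
    case (elim c)
    obtain s t d where c: "c = ((s, t), d)" by (metis surj_pair)
    have d: "0 < d" "0 \<le> s" "s + d \<le> 1" "0 \<le> t" "t + d \<le> 1"
      using elim(2) by (auto simp: c cells_def)
    have dx: "dist (s, t) x0 < r / 3" "d < r / 3"
      using elim(1) dist_fst_le[of c "(x0, 0)"] dist_snd_le[of c "(x0, 0)"] by (auto simp: c dist_real_def)
    let ?C = "cbox (s, t) (s + d, t + d)"
    have sub: "?C \<subseteq> unit_square"
      using d by (auto simp: cbox_Pair_eq)
    have near: "norm (P y - P x0) \<le> e / 2" if y: "y \<in> ?C" for y
    proof -
      obtain a b where ab: "y = (a, b)" "s \<le> a" "a \<le> s + d" "t \<le> b" "b \<le> t + d"
        using y by (cases y) (auto simp: cbox_Pair_eq)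
      have "dist y (s, t) \<le> norm (a - s) + norm (b - t)"
        unfolding ab(1) dist_norm diff_Pair by (rule norm_Pair_le)
      also have "\<dots> \<le> d + d" using ab by (intro add_mono) auto
      finally have "dist y x0 < r"
        using dist_triangle[of y x0 "(s, t)"] dx by simp
      then show ?thesis
        using r(2)[of y] y sub by (auto simp: dist_norm)
    qed
    have "P integrable_on ?C"
      by (rule integrable_continuous[OF continuous_on_subset[OF P sub]])
    then have "((\<lambda>y. P y - P x0) has_integral (integral ?C P - measure lborel ?C *\<^sub>R P x0)) ?C"
      by (intro has_integral_diff has_integral_const integrable_integral)
    then have "norm (integral ?C P - measure lborel ?C *\<^sub>R P x0) \<le> (e / 2) * measure lborel ?C"
      by (rule has_integral_bound[rotated]) (use e near in auto)
    moreover have "measure lborel ?C = d\<^sup>2"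
      unfolding content_Pair using d by (simp add: power2_eq_square)
    ultimately have "\<bar>integral ?C P - d\<^sup>2 * P x0\<bar> \<le> (e / 2) * d\<^sup>2"
      by simp
    moreover have "integral ?C P / d\<^sup>2 - P x0 = (integral ?C P - d\<^sup>2 * P x0) / d\<^sup>2"
      using d by (simp add: field_simps)
    ultimately have "dist (integral ?C P / d\<^sup>2) (P x0) \<le> e / 2"
      using d by (simp add: dist_real_def abs_divide divide_le_eq)
    then show ?case using e by (simp add: c)
  qed
qed

text \<open>Phase and integral of a cell have the same limit \<open>P x0\<close> after division by
  the area, whence the bound on their difference. The nonvanishing clause provides the nonzero links
  for the cancellation on the grid.\<close>

lemma cell_phase_local_estimate:
  assumes \<sigma>: "C1_surface \<sigma>" and x0: "x0 \<in> unit_square" and e: "e > 0"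
  defines "P \<equiv> \<lambda>(s, t). fubini_study_pullback \<sigma> s t"
  shows "\<forall>\<^sub>F c in at (x0, 0) within cells. cell_phase \<sigma> (fst c) (snd c) \<noteq> 0 \<and>
    cmod (cell_phase \<sigma> (fst c) (snd c) -
      exp (\<i> * of_real (integral (cbox (fst c) (fst c + (snd c, snd c))) P))) \<le> e * (snd c)\<^sup>2"
proof -
  let ?F = "at (x0, 0::real) within cells"
  obtain k V D where ch: "C1_chart \<sigma> k V D" and xV: "x0 \<in> V \<inter> unit_square"
    using C1_surface_chart[OF \<sigma> x0] .
  define W where "W y = affine_coord k (case_prod \<sigma> y)" for y
  have V: "open V" and cD: "\<And>v. continuous_on (V \<inter> unit_square) (\<lambda>y. D y v)"
    and dom: "\<And>y. y \<in> V \<inter> unit_square \<Longrightarrow> case_prod \<sigma> y \<in> affine_domain k"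
    and D: "\<And>y. y \<in> V \<inter> unit_square \<Longrightarrow> (W has_derivative D y) (at y within unit_square)"
    using ch unfolding C1_chart_def W_def[abs_def] by blast+
  have lim: "((\<lambda>c. fst c) \<longlongrightarrow> x0) ?F" "((\<lambda>c. snd c) \<longlongrightarrow> 0) ?F"
    using tendsto_fst[OF tendsto_ident_at, of "(x0, 0::real)" cells]
      tendsto_snd[OF tendsto_ident_at, of "(x0, 0::real)" cells] by simp_all
  have pos: "\<forall>\<^sub>F c in ?F. snd c > 0"
    using eventually_cells by eventually_elim (auto simp: cells_def)
  have inV: "\<forall>\<^sub>F c in ?F. fst c + snd c *\<^sub>R (a, b) \<in> V \<inter> unit_square"
    if ab: "0 \<le> a" "a \<le> 1" "0 \<le> b" "b \<le> 1" for a b :: real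
  proof -
    have "((\<lambda>c. fst c + snd c *\<^sub>R (a, b)) \<longlongrightarrow> x0 + 0 *\<^sub>R (a, b)) ?F"
      by (intro tendsto_intros lim)
    then have "\<forall>\<^sub>F c in ?F. fst c + snd c *\<^sub>R (a, b) \<in> V"
      by (rule topological_tendstoD) (use V xV in \<open>auto simp: zero_prod_def[symmetric]\<close>)
    then show ?thesis
      using eventually_cells
    proof eventually_elim
      case (elim c)
      then show ?case
        using cells_corner[of "fst c" "snd c", OF _ ab] by simp
    qed
  qed
  have W0: "((\<lambda>c. W (fst c)) \<longlongrightarrow> W x0) ?F"
  proof (rule continuous_within_tendsto_compose[OF _ _ lim(1)])
    show "continuous (at x0 within unit_square) W"
      by (rule has_derivative_continuous[OF D[OF xV]])
    show "\<forall>\<^sub>F c in ?F. fst c \<in> unit_square"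
      using eventually_cells by eventually_elim (auto simp: cells_def)
  qed
  have nz: "W x0 \<noteq> 0"
    unfolding W_def by (rule affine_coordD(4)[OF dom[OF xV]])
  note quot = tendsto_cell_difference_quotient[OF V xV D cD]
  have "((\<lambda>c. (W (fst c + snd c *\<^sub>R (1, 0)) - W (fst c)) /\<^sub>R snd c) \<longlongrightarrow> D x0 (1, 0)) ?F"
    "((\<lambda>c. (W (fst c + snd c *\<^sub>R (1, 1)) - W (fst c)) /\<^sub>R snd c) \<longlongrightarrow> D x0 (1, 1)) ?F"
    "((\<lambda>c. (W (fst c + snd c *\<^sub>R (0, 1)) - W (fst c)) /\<^sub>R snd c) \<longlongrightarrow> D x0 (0, 1)) ?F"
    by (rule quot; simp)+
  from cinner_cycle4_phase_limit[OF lim(2) pos W0 nz this]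
  obtain \<theta> where \<theta>: "\<forall>\<^sub>F c in ?F. sgn (cinner (W (fst c)) (W (fst c + snd c *\<^sub>R (1, 0))) *
        cinner (W (fst c + snd c *\<^sub>R (1, 0))) (W (fst c + snd c *\<^sub>R (1, 1))) *
        cinner (W (fst c + snd c *\<^sub>R (1, 1))) (W (fst c + snd c *\<^sub>R (0, 1))) *
        cinner (W (fst c + snd c *\<^sub>R (0, 1))) (W (fst c))) = exp (\<i> * of_real (\<theta> c))"
    and lim\<theta>: "((\<lambda>c. \<theta> c / (snd c)\<^sup>2) \<longlongrightarrow>
      Im (fs_herm (W x0) (D x0 (1, 0)) (D x0 (1, 1))) + Im (fs_herm (W x0) (D x0 (1, 1)) (D x0 (0, 1)))) ?F"
    by blast
  \<comment> \<open>With the diagonal split as a sum, both triangles contribute the same imaginary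
    part, and the terms \<open>fs_herm w x x\<close> are real.\<close>
  have "D x0 ((1, 0) + (0, 1)) = D x0 (1, 0) + D x0 (0, 1)"
    by (rule linear_add[OF bounded_linear.linear[OF has_derivative_bounded_linear[OF D[OF xV]]]])
  then have D11: "D x0 (1, 1) = D x0 (1, 0) + D x0 (0, 1)" by simp
  obtain s t where st: "x0 = (s, t)" by fastforce
  have "Im (fs_herm (W x0) (D x0 (1, 0)) (D x0 (1, 1))) + Im (fs_herm (W x0) (D x0 (1, 1)) (D x0 (0, 1))) = P x0"
    using fubini_study_pullback_chart[OF ch xV[unfolded st]]
    unfolding D11 fs_herm_add_left fs_herm_add_right
    by (simp add: Im_fs_herm_self P_def st W_def)
  with lim\<theta> have lim\<theta>: "((\<lambda>c. \<theta> c / (snd c)\<^sup>2) \<longlongrightarrow> P x0) ?F" by simp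
  let ?I = "\<lambda>c. integral (cbox (fst c) (fst c + (snd c, snd c))) P"
  have "((\<lambda>c. ?I c / (snd c)\<^sup>2) \<longlongrightarrow> P x0) ?F"
    unfolding P_def
    by (intro cell_integral_limit continuous_on_fubini_study_pullback \<sigma> x0)
  from tendsto_diff[OF lim\<theta> this]
  have "((\<lambda>c. \<theta> c / (snd c)\<^sup>2 - ?I c / (snd c)\<^sup>2) \<longlongrightarrow> 0) ?F" by simp
  from tendstoD[OF this e] have close: "\<forall>\<^sub>F c in ?F. dist (\<theta> c / (snd c)\<^sup>2 - ?I c / (snd c)\<^sup>2) 0 < e" .
  have in0: "\<forall>\<^sub>F c in ?F. fst c \<in> V \<inter> unit_square"
    using inV[of 0 0] by (simp add: zero_prod_def[symmetric])
  have in1: "\<forall>\<^sub>F c in ?F. fst c + snd c *\<^sub>R (1, 0) \<in> V \<inter> unit_square"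
    "\<forall>\<^sub>F c in ?F. fst c + snd c *\<^sub>R (1, 1) \<in> V \<inter> unit_square"
    "\<forall>\<^sub>F c in ?F. fst c + snd c *\<^sub>R (0, 1) \<in> V \<inter> unit_square"
    by (rule inV; simp)+
  show ?thesis
    using \<theta> close pos in0 in1
  proof eventually_elim
    case (elim c)
    have W: "case_prod \<sigma> y \<in> proj_space" "W y \<in> case_prod \<sigma> y" "W y \<noteq> 0" if "y \<in> V \<inter> unit_square" for y
      using affine_coordD[OF dom[OF that]] by (simp_all add: W_def)
    have "cell_phase \<sigma> (fst c) (snd c) = exp (\<i> * of_real (\<theta> c))"
      unfolding cell_phase_def Let_def elim(1)[symmetric]
      by (rule link_phase_cycle4[OF W[OF elim(4)] W[OF elim(5)] W[OF elim(6)] W[OF elim(7)]])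
    moreover have "\<bar>\<theta> c - ?I c\<bar> \<le> e * (snd c)\<^sup>2"
    proof -
      have "\<theta> c / (snd c)\<^sup>2 - ?I c / (snd c)\<^sup>2 = (\<theta> c - ?I c) / (snd c)\<^sup>2"
        by (simp only: diff_divide_distrib)
      then have "\<bar>\<theta> c - ?I c\<bar> / (snd c)\<^sup>2 < e"
        using elim(2) by (simp add: dist_real_def abs_divide)
      then show ?thesis
        using elim(3) by (simp add: divide_less_eq)
    qed
    ultimately show ?case
      using norm_exp_i_diff_le[of "\<theta> c" "?I c"] by (simp del: of_real_diff)
  qed
qed

text \<open>A Lebesgue number argument: half of the radius \<open>R x0\<close> is spent on the
  corner of the cell, half on its side length.\<close>

lemma cell_phase_uniform_estimate:
  assumes \<sigma>: "C1_surface \<sigma>" and e: "e > 0"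
  defines "P \<equiv> \<lambda>(s, t). fubini_study_pullback \<sigma> s t"
  obtains r where "r > 0" "\<And>x d. (x, d) \<in> cells \<Longrightarrow> d < r \<Longrightarrow> cell_phase \<sigma> x d \<noteq> 0 \<and>
    cmod (cell_phase \<sigma> x d - exp (\<i> * of_real (integral (cbox x (x + (d, d))) P))) \<le> e * d\<^sup>2"
proof -
  let ?E = "\<lambda>x d. cell_phase \<sigma> x d \<noteq> 0 \<and>
    cmod (cell_phase \<sigma> x d - exp (\<i> * of_real (integral (cbox x (x + (d, d))) P))) \<le> e * d\<^sup>2"
  have "\<exists>r>0. \<forall>c\<in>cells. c \<noteq> (x0, 0) \<and> dist c (x0, 0) < r \<longrightarrow> ?E (fst c) (snd c)"
    if "x0 \<in> unit_square" for x0
    using cell_phase_local_estimate[OF \<sigma> that e] unfolding P_def eventually_at .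
  then obtain R where R: "\<And>x0. x0 \<in> unit_square \<Longrightarrow> R x0 > 0"
    "\<And>x0 c. x0 \<in> unit_square \<Longrightarrow> c \<in> cells \<Longrightarrow> c \<noteq> (x0, 0) \<Longrightarrow> dist c (x0, 0) < R x0 \<Longrightarrow>
      ?E (fst c) (snd c)"
    by metis
  have comp: "compact unit_square"
    by (intro compact_Times compact_Icc)
  have cover: "unit_square \<subseteq> (\<Union>x\<in>unit_square. ball x (R x / 2))"
  proof
    fix x assume x: "x \<in> unit_square"
    then have "x \<in> ball x (R x / 2)" using R(1)[OF x] by simp
    with x show "x \<in> (\<Union>x\<in>unit_square. ball x (R x / 2))" by (rule UN_I)
  qed
  obtain X where X: "X \<subseteq> unit_square" "finite X" "unit_square \<subseteq> (\<Union>x\<in>X. ball x (R x / 2))"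
    by (rule compactE_image[OF comp, of unit_square "\<lambda>x. ball x (R x / 2)", OF open_ball cover])
  \<comment> \<open>Inserting 1 spares the question whether \<open>X\<close> is empty.\<close>
  define r where "r = Min (insert 1 ((\<lambda>x. R x / 2) ` X))"
  have "r > 0"
    using X R(1) by (auto simp: r_def)
  moreover have "?E x d" if xd: "(x, d) \<in> cells" "d < r" for x d
  proof -
    have x: "x \<in> unit_square" "d > 0" using xd by (auto simp: cells_def)
    then obtain x0 where x0: "x0 \<in> X" "dist x0 x < R x0 / 2" using X(3) by auto
    have "r \<le> R x0 / 2"
      unfolding r_def using X(2) x0(1) by (intro Min_le) auto
    moreover have "dist (x, d) (x0, 0) \<le> dist x x0 + d"
      using norm_Pair_le[of "x - x0" d] x(2) by (simp add: dist_norm)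
    ultimately have "dist (x, d) (x0, 0) < R x0"
      using x0(2) xd(2) by (simp add: dist_commute)
    then show ?thesis
      using R(2)[of x0 "(x, d)"] X(1) x0(1) xd(1) x(2) by auto
  qed
  ultimately show thesis using that by blast
qed

section \<open>Additivity of the integral over a grid, and the limit of fine grids\<close>

lemma sum_integral_grid:
  fixes f :: "real \<Rightarrow> real"
  assumes f: "f integrable_on {0..1}" and N: "N > 0" and n: "n \<le> N"
  shows "(\<Sum>i<n. integral {real i / real N..real (Suc i) / real N} f) = integral {0..real n / real N} f"
  using n
proof (induction n)
  case (Suc n)
  have le: "0 \<le> real n / real N" "real n / real N \<le> real (Suc n) / real N" "real (Suc n) / real N \<le> 1"
    using N Suc.prems by (auto simp: divide_simps)
  have "f integrable_on {0..real (Suc n) / real N}"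
    by (rule integrable_subinterval_real[OF f]) (use le in auto)
  from Henstock_Kurzweil_Integration.integral_combine[OF le(1,2) this]
  show ?case using Suc by simp
qed simp

text \<open>Fubini turns each cell integral into an iterated one; the cells are then added up in one
  variable at a time.\<close>

lemma sum_integral_grid2:
  fixes P :: "real \<times> real \<Rightarrow> real"
  assumes P: "continuous_on unit_square P" and N: "N > 0"
  shows "(\<Sum>i<N. \<Sum>j<N. integral (cbox (real i / real N, real j / real N)
      (real (Suc i) / real N, real (Suc j) / real N)) P) = integral unit_square P"
proof -
  let ?g = "\<lambda>i. real i / real N"
  have g: "0 \<le> ?g i" "?g (Suc i) \<le> 1" "?g i \<le> ?g (Suc i)" if "i < N" for i
    using that N by (auto simp: divide_simps)
  have inner: "(\<lambda>x. integral {a..b} (\<lambda>y. P (x, y))) integrable_on {0..1}" if "0 \<le> a" "b \<le> 1" for a b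
  proof -
    have "continuous_on ({0..1} \<times> cbox a b) (\<lambda>(x, y). P (x, y))"
      using that by (simp add: case_prod_unfold) (rule continuous_on_subset[OF P], auto)
    then have "continuous_on {0..1} (\<lambda>x. integral (cbox a b) (\<lambda>y. P (x, y)))"
      by (rule integral_continuous_on_param)
    then show ?thesis
      by (simp add: integrable_continuous_real)
  qed
  have fub: "integral (cbox (a, c) (b, d)) P = integral {a..b} (\<lambda>x. integral {c..d} (\<lambda>y. P (x, y)))"
    if "0 \<le> a" "b \<le> 1" "0 \<le> c" "d \<le> 1" for a b c d
  proof -
    have "continuous_on (cbox (a, c) (b, d)) P"
      by (rule continuous_on_subset[OF P]) (use that in \<open>auto simp: cbox_Pair_eq\<close>)
    then show ?thesis
      by (subst integral_prod_continuous) simp_all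
  qed
  have "(\<Sum>i<N. \<Sum>j<N. integral (cbox (?g i, ?g j) (?g (Suc i), ?g (Suc j))) P) =
      (\<Sum>j<N. \<Sum>i<N. integral {?g i..?g (Suc i)} (\<lambda>x. integral {?g j..?g (Suc j)} (\<lambda>y. P (x, y))))"
    by (subst sum.swap) (intro sum.cong refl fub g; simp)
  also have "\<dots> = (\<Sum>j<N. integral {0..1} (\<lambda>x. integral {?g j..?g (Suc j)} (\<lambda>y. P (x, y))))"
  proof (rule sum.cong[OF refl])
    fix j assume "j \<in> {..<N}"
    then have "(\<lambda>x. integral {?g j..?g (Suc j)} (\<lambda>y. P (x, y))) integrable_on {0..1}"
      by (intro inner g) auto
    from sum_integral_grid[OF this N order_refl]
    show "(\<Sum>i<N. integral {?g i..?g (Suc i)} (\<lambda>x. integral {?g j..?g (Suc j)} (\<lambda>y. P (x, y)))) =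
        integral {0..1} (\<lambda>x. integral {?g j..?g (Suc j)} (\<lambda>y. P (x, y)))"
      using N by simp
  qed
  also have "\<dots> = integral {0..1} (\<lambda>x. \<Sum>j<N. integral {?g j..?g (Suc j)} (\<lambda>y. P (x, y)))"
    by (rule integral_sum[symmetric]) (auto intro!: inner g)
  also have "\<dots> = integral {0..1} (\<lambda>x. integral {0..1} (\<lambda>y. P (x, y)))"
  proof (rule integral_cong)
    fix x :: real assume x: "x \<in> {0..1}"
    have "continuous_on {0..1} (\<lambda>y. P (x, y))"
      by (rule continuous_on_compose2[OF P]) (use x in \<open>auto intro!: continuous_intros\<close>)
    from sum_integral_grid[OF integrable_continuous_real[OF this] N order_refl]
    show "(\<Sum>j<N. integral {?g j..?g (Suc j)} (\<lambda>y. P (x, y))) = integral {0..1} (\<lambda>y. P (x, y))"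
      using N by simp
  qed
  also have "\<dots> = integral (cbox (0, 0) (1, 1)) P"
    by (rule fub[symmetric]) auto
  also have "cbox (0, 0) (1, 1) = unit_square"
    by (simp add: cbox_Pair_eq)
  finally show ?thesis .
qed

text \<open>A discrete Stokes theorem. The phases of the cells of a grid multiply to the phase of its
  boundary, whatever representatives are chosen at the grid points, and a cell of side \<open>d\<close>
  contributes its share of the integral up to \<open>o(d\<^sup>2)\<close>.\<close>

lemma boundary_phase_eq_exp_integral:
  assumes \<sigma>: "C1_surface \<sigma>"
    and bottom: "\<And>N. N > 0 \<Longrightarrow> (\<Prod>i<N. link_phase (\<sigma> (real i / real N) 0) (\<sigma> (real (Suc i) / real N) 0)) = B0"
    and right: "\<And>N. N > 0 \<Longrightarrow> (\<Prod>j<N. link_phase (\<sigma> 1 (real j / real N)) (\<sigma> 1 (real (Suc j) / real N))) = B1"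
    and top: "\<And>N. N > 0 \<Longrightarrow> (\<Prod>i<N. link_phase (\<sigma> (real i / real N) 1) (\<sigma> (real (Suc i) / real N) 1)) = B2"
    and left: "\<And>N. N > 0 \<Longrightarrow> (\<Prod>j<N. link_phase (\<sigma> 0 (real j / real N)) (\<sigma> 0 (real (Suc j) / real N))) = B3"
  shows "B0 * B1 * inverse B2 * inverse B3 = exp (\<i> * of_real (fubini_study_integral \<sigma>))"
proof -
  define P where "P = (\<lambda>(s, t). fubini_study_pullback \<sigma> s t)"
  define B where "B = B0 * B1 * inverse B2 * inverse B3"
  let ?\<Phi> = "fubini_study_integral \<sigma>"
  have "cmod (B - exp (\<i> * of_real ?\<Phi>)) \<le> e" if e: "e > 0" for e
  proof -
    obtain r where r: "r > 0" "\<And>x d. (x, d) \<in> cells \<Longrightarrow> d < r \<Longrightarrow> cell_phase \<sigma> x d \<noteq> 0 \<and>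
        cmod (cell_phase \<sigma> x d - exp (\<i> * of_real (integral (cbox x (x + (d, d))) P))) \<le> e * d\<^sup>2"
      using cell_phase_uniform_estimate[OF \<sigma> e] unfolding P_def by blast
    obtain N where N: "N > 0" "1 / real N < r"
      using real_arch_invD[OF r(1)] by (auto simp: inverse_eq_divide)
    let ?g = "\<lambda>i. real i / real N"
    have step: "?g i + 1 / real N = ?g (Suc i)" for i
      by (simp add: add_divide_distrib)
    have cell: "((?g i, ?g j), 1 / real N) \<in> cells" if "i < N" "j < N" for i j
      using that N(1) by (auto simp: cells_def divide_simps)
    define h where "h i j = link_phase (\<sigma> (?g i) (?g j)) (\<sigma> (?g (Suc i)) (?g j))" for i j
    define v where "v i j = link_phase (\<sigma> (?g i) (?g j)) (\<sigma> (?g i) (?g (Suc j)))" for i j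
    let ?c = "\<lambda>i j. cell_phase \<sigma> (?g i, ?g j) (1 / real N)"
    let ?I = "\<lambda>i j. integral (cbox (?g i, ?g j) (?g (Suc i), ?g (Suc j))) P"
    \<comment> \<open>Reversed edges become inverses by \<open>link_phase_inverse\<close>, the shape
      that \<open>prod_grid_telescope\<close> expects.\<close>
    have c: "?c i j = h i j * v (Suc i) j * inverse (h i (Suc j)) * inverse (v i j)" for i j
      unfolding h_def v_def link_phase_inverse[symmetric]
      by (simp add: cell_phase_def Let_def step del: of_nat_Suc)
    have est: "?c i j \<noteq> 0" "cmod (?c i j - exp (\<i> * of_real (?I i j))) \<le> e * (1 / real N)\<^sup>2"
      if "i < N" "j < N" for i j
      using r(2)[OF cell[OF that] N(2)] by (simp_all add: step del: of_nat_Suc)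
    \<comment> \<open>A nonzero cell phase has four nonzero factors; on a coarse grid neighbouring
      points could be orthogonal.\<close>
    have nz: "h i j \<noteq> 0" "v (Suc i) j \<noteq> 0" "h i (Suc j) \<noteq> 0" "v i j \<noteq> 0" if "i < N" "j < N" for i j
      using est(1)[OF that] unfolding c by auto
    \<comment> \<open>The row \<open>j = N\<close> is the lower edge of no cell and is reached as
      the upper edge of the cell \<open>j - 1\<close>; the column \<open>i = N\<close> is treated
      alike below.\<close>
    have hnz: "h i j \<noteq> 0" if "i < N" "j \<le> N" for i j
      using nz(1,3)[of i "j - 1"] nz(1)[of i j] that by (cases j) auto
    have vnz: "v i j \<noteq> 0" if "i \<le> N" "j < N" for i j
      using nz(2,4)[of "i - 1" j] nz(4)[of i j] that by (cases i) auto
    have "(\<Prod>i<N. \<Prod>j<N. ?c i j) =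
        (\<Prod>i<N. h i 0) * (\<Prod>j<N. v N j) * inverse (\<Prod>i<N. h i N) * inverse (\<Prod>j<N. v 0 j)"
      unfolding c by (rule prod_grid_telescope[OF hnz vnz])
    also have "\<dots> = B"
      unfolding B_def h_def v_def
      using bottom[OF N(1)] right[OF N(1)] top[OF N(1)] left[OF N(1)] N(1) by simp
    finally have pc: "(\<Prod>p\<in>{..<N} \<times> {..<N}. ?c (fst p) (snd p)) = B"
      by (simp add: prod.cartesian_product case_prod_unfold)
    have "(\<Sum>p\<in>{..<N} \<times> {..<N}. ?I (fst p) (snd p)) = ?\<Phi>"
      using sum_integral_grid2[OF continuous_on_fubini_study_pullback[OF \<sigma>] N(1)]
      unfolding fubini_study_integral_def P_def by (simp add: sum.cartesian_product case_prod_unfold)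
    then have pe: "(\<Prod>p\<in>{..<N} \<times> {..<N}. exp (\<i> * of_real (?I (fst p) (snd p)))) = exp (\<i> * of_real ?\<Phi>)"
      by (simp add: exp_sum[symmetric] sum_distrib_left[symmetric] of_real_sum[symmetric] del: of_real_sum)
    have "cmod (B - exp (\<i> * of_real ?\<Phi>)) \<le>
        (\<Sum>p\<in>{..<N} \<times> {..<N}. cmod (?c (fst p) (snd p) - exp (\<i> * of_real (?I (fst p) (snd p)))))"
      unfolding pc[symmetric] pe[symmetric]
      by (rule norm_prod_diff) (simp_all add: norm_cell_phase_le)
    also have "\<dots> \<le> (\<Sum>p\<in>{..<N} \<times> {..<N}. e * (1 / real N)\<^sup>2)"
      by (rule sum_mono, rule est(2)) auto
    also have "\<dots> = e"
      using N(1) by (simp add: power2_eq_square)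
    finally show ?thesis .
  qed
  then have "cmod (B - exp (\<i> * of_real ?\<Phi>)) \<le> 0"
    by (rule field_le_epsilon[of _ 0, simplified])
  then show ?thesis by (simp add: B_def)
qed

section \<open>The geodesic triangle and the three-point function\<close>

lemma cayley_dist_commute: "cayley_dist p r = cayley_dist r p"
  unfolding cayley_dist_def Let_def
  by (subst cinner_commute) (simp add: mult.commute)

text \<open>The bottom edge of the square is the single point \<open>r\<close> and contributes 1;
  counterclockwise follow \<open>r\<close> to \<open>q\<close>, \<open>q\<close> to \<open>p\<close>
  and \<open>p\<close> to \<open>r\<close>. Each side is shorter than \<open>pi / 2\<close>, so its
  grid product collapses to one link.\<close>

lemma triangle_phase:
  assumes def: "triangle_deformation p q r \<tau>"
    and lt: "cayley_dist p q < pi / 2" "cayley_dist q r < pi / 2" "cayley_dist r p < pi / 2"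
  shows "link_phase r q * link_phase q p * link_phase p r = exp (\<i> * of_real (fubini_study_integral \<tau>))"
proof -
  obtain \<sigma> where \<sigma>: "geodesic_triangle p q r \<sigma>" and C1: "C1_surface \<tau>"
    and bd: "\<And>s t. s \<in> {0..1} \<Longrightarrow> t \<in> {0..1} \<Longrightarrow> s \<in> {0, 1} \<or> t \<in> {0, 1} \<Longrightarrow> \<tau> s t = \<sigma> s t"
    using def unfolding triangle_deformation_def by blast
  have pq: "geodesic p q (\<lambda>s. \<sigma> s 1)" and sw: "\<And>s. s \<in> {0..1} \<Longrightarrow> geodesic r (\<sigma> s 1) (\<sigma> s)"
    using \<sigma> unfolding geodesic_triangle_def by auto
  have ends: "\<sigma> 0 1 = p" "\<sigma> 1 1 = q" using pq unfolding geodesic_def by auto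
  have rp: "geodesic r p (\<sigma> 0)" and rq: "geodesic r q (\<sigma> 1)"
    using sw[of 0] sw[of 1] ends by auto
  have r: "\<sigma> s 0 = r" "r \<in> proj_space" if "s \<in> {0..1}" for s
    using sw[OF that] unfolding geodesic_def by auto
  have g: "real i / real N \<in> {0..1}" "real (Suc i) / real N \<in> {0..1}" if "i < N" for i N
    using that by (auto simp: divide_simps)
  have "1 * link_phase r q * inverse (link_phase p q) * inverse (link_phase r p) =
      exp (\<i> * of_real (fubini_study_integral \<tau>))"
  proof (rule boundary_phase_eq_exp_integral[OF C1])
    fix N :: nat assume N: "N > 0"
    show "(\<Prod>i<N. link_phase (\<tau> (real i / real N) 0) (\<tau> (real (Suc i) / real N) 0)) = 1"
      by (rule prod.neutral) (use g[of _ N] r(1) link_phase_self[OF r(2)[of 0]] bd in auto)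
    have "(\<Prod>j<N. link_phase (\<tau> 1 (real j / real N)) (\<tau> 1 (real (Suc j) / real N))) =
        (\<Prod>j<N. link_phase (\<sigma> 1 (real j / real N)) (\<sigma> 1 (real (Suc j) / real N)))"
      by (rule prod.cong[OF refl]) (use g[of _ N] bd in simp)
    then show "(\<Prod>j<N. link_phase (\<tau> 1 (real j / real N)) (\<tau> 1 (real (Suc j) / real N))) = link_phase r q"
      using geodesic_link_phase_prod[OF rq _ order_refl N] lt(2) ends N by (simp add: cayley_dist_commute[of r q])
    have "(\<Prod>j<N. link_phase (\<tau> (real j / real N) 1) (\<tau> (real (Suc j) / real N) 1)) =
        (\<Prod>j<N. link_phase (\<sigma> (real j / real N) 1) (\<sigma> (real (Suc j) / real N) 1))"
      by (rule prod.cong[OF refl]) (use g[of _ N] bd in simp)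
    then show "(\<Prod>j<N. link_phase (\<tau> (real j / real N) 1) (\<tau> (real (Suc j) / real N) 1)) = link_phase p q"
      using geodesic_link_phase_prod[OF pq _ order_refl N] lt(1) ends N by simp
    have "(\<Prod>j<N. link_phase (\<tau> 0 (real j / real N)) (\<tau> 0 (real (Suc j) / real N))) =
        (\<Prod>j<N. link_phase (\<sigma> 0 (real j / real N)) (\<sigma> 0 (real (Suc j) / real N)))"
      by (rule prod.cong[OF refl]) (use g[of _ N] bd in simp)
    then show "(\<Prod>j<N. link_phase (\<tau> 0 (real j / real N)) (\<tau> 0 (real (Suc j) / real N))) = link_phase r p"
      using geodesic_link_phase_prod[OF rp _ order_refl N] lt(3) ends N by simp
  qed
  then show ?thesis
    unfolding link_phase_inverse[of p q, symmetric] link_phase_inverse[of r p, symmetric]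
    by (simp only: link_phase_inverse[symmetric] mult_1_left)
qed

theorem theorem4p8:
  fixes A :: "('m::t2_space, 'n::finite) atlas"
    and \<omega> :: "('m, 'n) form"
    and L :: "('l, 'm) line_bundle"
    and h :: "'l \<Rightarrow> 'l \<Rightarrow> complex"
    and s :: "'k::finite \<Rightarrow> 'm \<Rightarrow> 'l"
    and i :: "'m \<Rightarrow> 'k point"
    and x y z :: 'm
    and q q' q'' :: 'l
    and a b c \<Phi> :: real
    and \<sigma> :: "real \<Rightarrow> real \<Rightarrow> 'k point"
  assumes "compact (UNIV :: 'm set)" and "connected (UNIV :: 'm set)"
    and "complex_atlas A" and "kaehler_form A \<omega>"
    and "quantum_line_bundle A \<omega> L h" and "very_ample TYPE('k) A L"
    and "orthonormal_section_basis A \<omega> L h s" and "i = projective_map L s"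
    and "q \<in> nonzero_vectors L" and "q' \<in> nonzero_vectors L" and "q'' \<in> nonzero_vectors L"
    and "x = lb_proj L q" and "y = lb_proj L q'" and "z = lb_proj L q''"
    and "a = cayley_dist (i x) (i y)" and "b = cayley_dist (i y) (i z)"
    and "c = cayley_dist (i z) (i x)"
    and "0 < a" and "a < pi / 2" and "0 < b" and "b < pi / 2" and "0 < c" and "c < pi / 2"
    and "triangle_deformation (i x) (i y) (i z) \<sigma>"
    and "\<Phi> = fubini_study_integral \<sigma>"
  shows "three_point A \<omega> L h q q' q'' =
           of_real (cos a) * of_real (cos b) * of_real (cos c) * exp (\<i> * of_real \<Phi>)"
proof -
  have \<omega>: "is_form11 A \<omega>"
    using assms(4) unfolding kaehler_form_def by blast
  have L: "holomorphic_line_bundle A L" and h: "hermitian_metric A L h"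
    using assms(5) unfolding quantum_line_bundle_def by simp_all
  have "range s \<subseteq> hol_sections A L"
    using assms(7) unfolding orthonormal_section_basis_def section_basis_def by (elim conjE)
  then have sp: "lb_proj L (s j m) = m" for j m
    by (intro hol_sections_proj) blast
  define u where "u p = (\<chi> j. qhat L p (s j))" for p
  note inner = section_inner_coherent_vectors[OF assms(1,3) \<omega> L h assms(7), folded u_def]
  have i: "i (lb_proj L p) = proj_point (u p)" if "p \<in> nonzero_vectors L" for p
    unfolding assms(8) u_def by (rule projective_map_eq[OF L sp that])
  \<comment> \<open>The geodesics of the triangle put the three points in \<open>proj_space\<close>,
    so that their coordinate vectors are nonzero.\<close>
  obtain \<sigma>' where "geodesic_triangle (i x) (i y) (i z) \<sigma>'"
    using assms(24) unfolding triangle_deformation_def by blast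
  then have "geodesic (i x) (i y) (\<lambda>s. \<sigma>' s 1)" "geodesic (i z) (\<sigma>' 0 1) (\<sigma>' 0)"
    unfolding geodesic_triangle_def by auto
  from geodesic_endpoints[OF this(1)] geodesic_endpoints(1)[OF this(2)]
  have P: "i x \<in> proj_space" "i y \<in> proj_space" "i z \<in> proj_space" .
  have ix: "i x = proj_point (u q)" and iy: "i y = proj_point (u q')" and iz: "i z = proj_point (u q'')"
    using i assms(9-14) by auto
  have nz: "u q \<noteq> 0" "u q' \<noteq> 0" "u q'' \<noteq> 0"
    using P unfolding ix iy iz by (auto dest: nonzero_if_proj_point_in_proj_space)
  have mem: "u q \<in> i x" "u q' \<in> i y" "u q'' \<in> i z"
    unfolding ix iy iz by (rule in_proj_point)+
  note X = P(1) mem(1) nz(1) and Y = P(2) mem(2) nz(2) and Z = P(3) mem(3) nz(3)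
  \<comment> \<open>Scalar products of coherent vectors reverse the order, so the cycle runs through
    \<open>z\<close>, \<open>y\<close>, \<open>x\<close>, as in
    \<open>triangle_phase\<close>.\<close>
  let ?Z = "cinner (u q'') (u q') * cinner (u q') (u q) * cinner (u q) (u q'')"
  have norm: "(section_norm A \<omega> h (coherent_vector A \<omega> L h p))\<^sup>2 = (norm (u p))\<^sup>2"
    if "p \<in> nonzero_vectors L" for p
    unfolding section_norm_def inner[OF that that] cinner_self by simp
  have "three_point A \<omega> L h q q' q'' =
      ?Z / of_real ((norm (u q))\<^sup>2 * (norm (u q'))\<^sup>2 * (norm (u q''))\<^sup>2)"
    unfolding three_point_def Let_def norm[OF assms(9)] norm[OF assms(10)] norm[OF assms(11)]
      inner[OF assms(9,10)] inner[OF assms(10,11)] inner[OF assms(11,9)]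
    by (simp add: mult_ac)
  also have "?Z = of_real (cmod ?Z) * sgn ?Z"
    by (simp add: sgn_eq)
  also have "sgn ?Z = exp (\<i> * of_real \<Phi>)"
    unfolding link_phase_cycle3[OF Z Y X, symmetric] assms(25)
    by (rule triangle_phase[OF assms(24)]) (use assms(15-23) in auto)
  also have "of_real (cmod ?Z) * exp (\<i> * of_real \<Phi>) /
      of_real ((norm (u q))\<^sup>2 * (norm (u q'))\<^sup>2 * (norm (u q''))\<^sup>2) =
      of_real (cos a * cos b * cos c) * exp (\<i> * of_real \<Phi>)"
  proof -
    have sym: "cmod (cinner v w) = cmod (cinner w v)" for v w :: "complex^'k"
      by (subst cinner_commute) simp
    \<comment> \<open>Every vertex belongs to two sides, which produces the squared norms in the
      denominator.\<close>
    have "cos a * cos b * cos c =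
        cmod ?Z / ((norm (u q))\<^sup>2 * (norm (u q'))\<^sup>2 * (norm (u q''))\<^sup>2)"
      unfolding assms(15-17) cos_cayley_dist(1)[OF X Y] cos_cayley_dist(1)[OF Y Z]
        cos_cayley_dist(1)[OF Z X] norm_mult
        sym[of "u q" "u q'"] sym[of "u q'" "u q''"] sym[of "u q''" "u q"]
      by (simp add: power2_eq_square mult_ac)
    then show ?thesis
      by (simp only: of_real_divide times_divide_eq_left)
  qed
  finally show ?thesis
    by (simp only: of_real_mult)
qed

end
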